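(* Let $m\ge2$ and let $V$ be the irreducible representation of $GL(m,\mathbb{R})$ characterized by $(D,n,0)$, where $D=(d_1,\dots,d_{m-1})$ is a Young diagram of size $d=\sum_i d_i$ and $n\in\mathbb{Z}$. Put $d_m=0$, let $Q=\{q\in\mathbb{N}^{m-1}:0\le q_i\le d_i-d_{i+1}\text{ for all }i\}$, and for $q\in Q$ put $q_m=0$ and $|q|=\sum_i q_i$. Then the set of resonant values for $V$ is $$\Bigl\{\frac{|q|\,(2(m+1)(n+1)+2d-|q|)+\sum_{i=1}^{m}(2d_iq_i-q_i^2-2iq_i)}{2|q|(m+1)}\;:\;q\in Q\setminus\{0\}\Bigr\}.$$ In particular, there is only a finite number of resonant values for any representation $(V,\rho)$ of $GL(m,\mathbb{R})$ (finite direct sum of irreducible representations characterized by triples of the form $(D,n,0)$), and $0$ is never resonant for the irreducible representation characterized by $(D,n,0)$ whenever $n\ge 0$.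
   Context: A Young diagram of depth at most $m-1$ is $D=(d_1,\dots,d_{m-1})$ with integers $d_1\ge\dots\ge d_{m-1}\ge0$. For $n\in\mathbb{Z}$ and $\delta\in\mathbb{C}$, the irreducible representation of $GL(m,\mathbb{R})$ characterized by $(D,n,\delta)$ is the span in $\otimes^d\mathbb{R}^m$ of the orbit of $e_1^{\otimes(d_1-d_2)}\otimes(e_1\wedge e_2)^{\otimes(d_2-d_3)}\otimes\cdots\otimes(e_1\wedge\cdots\wedge e_{m-1})^{\otimes d_{m-1}}$, on which $A$ acts by $|\det A|^{-\delta}(\det A)^n\rho_c(A)$, $\rho_c$ being the canonical action on tensors (complexified if needed). The eigenvalue associated to $(D,n,\delta)$ is $$\alpha(D,n,\delta)=\frac{(m(n-\delta)+d)(m(n+1-\delta)+d)}{2m}+\frac{1}{2m(m+1)}\sum_{i,j=1}^m\bigl(d_id_j(m\delta_{ij}-1)+2d_i(m-j)(m\delta_{ij}-1)\bigr),$$ where $d$ is the size of $D$, $d_m=0$, and $\delta_{ij}$ is the Kronecker symbol. Let $\tilde V$ be the irreducible representation of $GL(m+1,\mathbb{R})$ characterized by $(D,n,0)$. Restricted to $GL(m,\mathbb{R})$ (embedded by $A\mapsto\mathrm{diag}(A,1)$) it decomposes without multiplicity as $\bigoplus_{q\in Q}V_q$, where $V_q$ is characterized by $(D-q,n,0)$. A complex number $\delta$ is resonant for $V$ if there exists $q\in Q\setminus\{0\}$ such that $\alpha(D-q,n,\delta)=\alpha(D,n,\delta)$. If $V$ is not irreducible, $\delta$ is resonant for $V$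 if it is resonant for one of its irreducible components. *)

theory Defs
  imports "Jordan_Normal_Form.Determinant" "HOL-Library.Function_Algebras"
begin

instantiation "fun" :: (type, real_vector) real_vector
begin

definition scaleR_fun :: "real \<Rightarrow> ('a \<Rightarrow> 'b) \<Rightarrow> 'a \<Rightarrow> 'b"
  where "scaleR_fun c f = (\<lambda>x. c *\<^sub>R f x)"

instance
  by standard (auto simp: scaleR_fun_def fun_eq_iff scaleR_add_right scaleR_add_left)

end

definition GL :: "nat \<Rightarrow> real mat set"
  where "GL m = {A \<in> carrier_mat m m. det A \<noteq> 0}"

subsection \<open>Representations\<close>

text \<open>
  A representation is a pair of a subspace \<open>V\<close> of some real vector space and an
  action \<open>\<rho>\<close>; only the values \<open>\<rho> A x\<close> with \<open>A\<close> invertible and \<open>x\<close> in \<open>V\<close> matter.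
\<close>

definition representation :: "nat \<Rightarrow> 'v::real_vector set \<Rightarrow> (real mat \<Rightarrow> 'v \<Rightarrow> 'v) \<Rightarrow> bool"
  where "representation m V \<rho> \<longleftrightarrow>
    subspace V \<and>
    (\<forall>A\<in>GL m. \<forall>x\<in>V. \<rho> A x \<in> V) \<and>
    (\<forall>A\<in>GL m. \<forall>x\<in>V. \<forall>y\<in>V. \<rho> A (x + y) = \<rho> A x + \<rho> A y) \<and>
    (\<forall>A\<in>GL m. \<forall>c. \<forall>x\<in>V. \<rho> A (c *\<^sub>R x) = c *\<^sub>R \<rho> A x) \<and>
    (\<forall>x\<in>V. \<rho> (1\<^sub>m m) x = x) \<and>
    (\<forall>A\<in>GL m. \<forall>B\<in>GL m. \<forall>x\<in>V. \<rho> (A * B) x = \<rho> A (\<rho> B x))"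

definition irreducible_rep :: "nat \<Rightarrow> 'v::real_vector set \<Rightarrow> (real mat \<Rightarrow> 'v \<Rightarrow> 'v) \<Rightarrow> bool"
  where "irreducible_rep m V \<rho> \<longleftrightarrow>
    representation m V \<rho> \<and> V \<noteq> {0} \<and>
    (\<forall>W. W \<subseteq> V \<and> representation m W \<rho> \<longrightarrow> W = {0} \<or> W = V)"

definition isomorphic_reps ::
    "nat \<Rightarrow> 'v::real_vector set \<Rightarrow> (real mat \<Rightarrow> 'v \<Rightarrow> 'v) \<Rightarrow>
     'w::real_vector set \<Rightarrow> (real mat \<Rightarrow> 'w \<Rightarrow> 'w) \<Rightarrow> bool"
  where "isomorphic_reps m V \<rho> W \<sigma> \<longleftrightarrow>
    representation m V \<rho> \<and> representation m W \<sigma> \<and>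
    (\<exists>f. linear f \<and> bij_betw f V W \<and> (\<forall>A\<in>GL m. \<forall>x\<in>V. f (\<rho> A x) = \<sigma> A (f x)))"

subsection \<open>Tensors\<close>

text \<open>
  A tensor over \<open>\<real>\<^sup>m\<close> is given by its coordinates: \<open>T [i\<^sub>1, \<dots>, i\<^sub>d]\<close> is the coefficient of
  \<open>e\<^bsub>i\<^sub>1\<^esub> \<otimes> \<dots> \<otimes> e\<^bsub>i\<^sub>d\<^esub>\<close>. The basis vectors are numbered from 0, so the
  vectors \<open>e\<^sub>1, \<dots>, e\<^sub>m\<close> of the standard notation have the indices \<open>0, \<dots>, m - 1\<close>.
\<close>

type_synonym tensor = "nat list \<Rightarrow> real"

definition basis_tensor :: "nat list \<Rightarrow> tensor"
  where "basis_tensor I = (\<lambda>J. if J = I then 1 else 0)"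

definition tensor_prod :: "tensor \<Rightarrow> tensor \<Rightarrow> tensor"
  where "tensor_prod S T = (\<lambda>I. \<Sum>k\<le>length I. S (take k I) * T (drop k I))"

definition wedge :: "nat \<Rightarrow> tensor"
  where "wedge k = (\<Sum>p | p permutes {..<k}. of_int (sign p) *\<^sub>R basis_tensor (map p [0..<k]))"

text \<open>The canonical action of a matrix on tensors of all degrees over \<open>\<real>\<^sup>m\<close>.\<close>

definition tensor_action :: "nat \<Rightarrow> real mat \<Rightarrow> tensor \<Rightarrow> tensor"
  where "tensor_action m A T = (\<lambda>I.
    if set I \<subseteq> {..<m}
    then \<Sum>J | length J = length I \<and> set J \<subseteq> {..<m}. (\<Prod>k<length I. A $$ (I ! k, J ! k)) * T J
    else 0)"

subsection \<open>Young diagrams and the representations they characterize\<close>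

text \<open>
  A diagram \<open>(d\<^sub>1, \<dots>, d\<^bsub>m-1\<^esub>)\<close> is a function indexed from 1 and vanishing
  outside \<open>{1..<m}\<close>; in particular \<open>D m = 0\<close>.
\<close>

definition young_diagram :: "nat \<Rightarrow> (nat \<Rightarrow> nat) \<Rightarrow> bool"
  where "young_diagram m D \<longleftrightarrow>
    (\<forall>i\<in>{1..<m}. D (Suc i) \<le> D i) \<and> (\<forall>i. i \<notin> {1..<m} \<longrightarrow> D i = 0)"

definition size_of :: "nat \<Rightarrow> (nat \<Rightarrow> nat) \<Rightarrow> nat"
  where "size_of m D = (\<Sum>i\<in>{1..<m}. D i)"

definition highest_tensor :: "nat \<Rightarrow> (nat \<Rightarrow> nat) \<Rightarrow> tensor"
  where "highest_tensor m D =
    foldr tensor_prod (concat (map (\<lambda>k. replicate (D k - D (Suc k)) (wedge k)) [1..<m]))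
      (basis_tensor [])"

definition model_space :: "nat \<Rightarrow> (nat \<Rightarrow> nat) \<Rightarrow> tensor set"
  where "model_space m D = span ((\<lambda>A. tensor_action m A (highest_tensor m D)) ` GL m)"

text \<open>
  Complexification is only needed for a weight \<open>\<delta>\<close> that is not real. The weight of a
  representation is therefore taken to be real here; resonance only involves
  representations of weight 0. (The argument \<open>\<delta>\<close> of the eigenvalue below is complex.)
\<close>

definition model_action :: "nat \<Rightarrow> int \<Rightarrow> real \<Rightarrow> real mat \<Rightarrow> tensor \<Rightarrow> tensor"
  where "model_action m n \<delta> A T =
    (\<bar>det A\<bar> powr (-\<delta>) * (det A) powi n) *\<^sub>R tensor_action m A T"

definition characterized_by ::
    "nat \<Rightarrow> 'v::real_vector set \<Rightarrow> (real mat \<Rightarrow> 'v \<Rightarrow> 'v) \<Rightarrow> (nat \<Rightarrow> nat) \<Rightarrow> int \<Rightarrow> real \<Rightarrow> bool"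
  where "characterized_by m V \<rho> D n \<delta> \<longleftrightarrow>
    young_diagram m D \<and> isomorphic_reps m (model_space m D) (model_action m n \<delta>) V \<rho>"

text \<open>The sum is internal: \<open>V\<close> is the direct sum of the subspaces \<open>W 0, \<dots>, W (r - 1)\<close>.\<close>

definition finite_sum_of_irreps ::
    "nat \<Rightarrow> 'v::real_vector set \<Rightarrow> (real mat \<Rightarrow> 'v \<Rightarrow> 'v) \<Rightarrow> bool"
  where "finite_sum_of_irreps m V \<rho> \<longleftrightarrow>
    representation m V \<rho> \<and>
    (\<exists>(r::nat) W.
      (\<forall>i<r. \<exists>D n. characterized_by m (W i) \<rho> D n 0) \<and>
      V = {\<Sum>i<r. x i | x. \<forall>i<r. x i \<in> W i} \<and>
      (\<forall>x. (\<forall>i<r. x i \<in> W i) \<and> (\<Sum>i<r. x i) = 0 \<longrightarrow> (\<forall>i<r. x i = 0)))"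

subsection \<open>Resonance\<close>

definition alpha :: "nat \<Rightarrow> (nat \<Rightarrow> nat) \<Rightarrow> int \<Rightarrow> complex \<Rightarrow> complex"
  where "alpha m D n \<delta> =
    (of_nat m * (of_int n - \<delta>) + of_nat (size_of m D)) *
    (of_nat m * (of_int n + 1 - \<delta>) + of_nat (size_of m D)) / (2 * of_nat m) +
    1 / (2 * of_nat m * (of_nat m + 1)) *
    (\<Sum>i = 1..m. \<Sum>j = 1..m.
      of_nat (D i) * of_nat (D j) * (of_nat m * of_bool (i = j) - 1) +
      2 * of_nat (D i) * (of_nat m - of_nat j) * (of_nat m * of_bool (i = j) - 1))"

text \<open>
  The index set of the branching rule: the irreducible representation of \<open>GL(m+1)\<close> with
  data \<open>(D, n, 0)\<close>, restricted to \<open>GL(m)\<close>, is the multiplicity-free sum of the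
  representations with data \<open>(D - q, n, 0)\<close> for \<open>q\<close> in this set. As for diagrams,
  \<open>q\<close> is extended by 0, so that \<open>q m = 0\<close>.
\<close>

definition branching_set :: "nat \<Rightarrow> (nat \<Rightarrow> nat) \<Rightarrow> (nat \<Rightarrow> nat) set"
  where "branching_set m D =
    {q. (\<forall>i\<in>{1..<m}. q i \<le> D i - D (Suc i)) \<and> (\<forall>i. i \<notin> {1..<m} \<longrightarrow> q i = 0)}"

definition resonant_irrep ::
    "nat \<Rightarrow> 'v::real_vector set \<Rightarrow> (real mat \<Rightarrow> 'v \<Rightarrow> 'v) \<Rightarrow> complex \<Rightarrow> bool"
  where "resonant_irrep m V \<rho> \<delta> \<longleftrightarrow>
    (\<exists>D n. characterized_by m V \<rho> D n 0 \<and>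
      (\<exists>q\<in>branching_set m D - {\<lambda>_. 0}. alpha m (\<lambda>i. D i - q i) n \<delta> = alpha m D n \<delta>))"

definition resonant ::
    "nat \<Rightarrow> 'v::real_vector set \<Rightarrow> (real mat \<Rightarrow> 'v \<Rightarrow> 'v) \<Rightarrow> complex \<Rightarrow> bool"
  where "resonant m V \<rho> \<delta> \<longleftrightarrow>
    (if irreducible_rep m V \<rho> then resonant_irrep m V \<rho> \<delta>
     else \<exists>W. W \<subseteq> V \<and> irreducible_rep m W \<rho> \<and> resonant_irrep m W \<rho> \<delta>)"

end

(*
Since alpha is a quadratic in delta whose leading coefficient does not depend on D, the resonance
equation is linear in delta with slope |q|, and solving it gives the formula. What remains is that
V is irreducible and determines (D, n).

The highest tensor h is a product of wedges, so every coordinate e_I of A h with minimal index sum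
is a product of leading minors of A times the coordinate of h. With the standard inner product the
adjoint of A is its transpose. Hence a subrepresentation W of the model space is either orthogonal
to h, thus to the whole orbit, and W = 0; or the torus element diag(2^i) isolates a nonzero multiple
of h in W, and W is everything. So the model spaces are irreducible.

The torus elements with j entries 2 and the others 1 act on h with exponents
j n + d_1 + ... + d_j, and these partial sums dominate those of all other weights of the model
space. Isomorphic models therefore have the same (D, n). In a finite direct sum, the components of
the highest weight vector of a subrepresentation are weight vectors of the summands, which
leaves finitely many (D, n).
*)

theory Submission
  imports Defs
begin

subsection \<open>Action on wedges\<close>

definition index_lists :: "nat \<Rightarrow> nat \<Rightarrow> nat list set"
  where "index_lists m l = {J. length J = l \<and> set J \<subseteq> {..<m}}"

lemma finite_index_lists [simp]: "finite (index_lists m l)"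
  using finite_lists_length_eq[of "{..<m}" l] by (simp add: index_lists_def conj_commute)

lemma tensor_action_altdef:
  "tensor_action m A T I = (if set I \<subseteq> {..<m}
     then \<Sum>J\<in>index_lists m (length I). (\<Prod>k<length I. A $$ (I ! k, J ! k)) * T J else 0)"
  by (simp add: tensor_action_def index_lists_def)

text \<open>Concatenation is a bijection from pairs of multi-indices of lengths \<open>k\<close> and
  \<open>l - k\<close> onto those of length \<open>l\<close>, so the sum factors.\<close>

lemma sum_index_lists_split:
  fixes F G :: "nat list \<Rightarrow> real"
  assumes "k \<le> l"
  shows "(\<Sum>J\<in>index_lists m l. F (take k J) * G (drop k J)) =
    (\<Sum>J\<in>index_lists m k. F J) * (\<Sum>J\<in>index_lists m (l - k). G J)"
proof -
  have "(\<Sum>J\<in>index_lists m k. F J) * (\<Sum>J\<in>index_lists m (l - k). G J) =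
    (\<Sum>(J1, J2)\<in>index_lists m k \<times> index_lists m (l - k). F J1 * G J2)"
    by (simp add: sum_product sum.cartesian_product)
  also have "\<dots> = (\<Sum>J\<in>index_lists m l. F (take k J) * G (drop k J))"
    by (rule sum.reindex_bij_witness[where i = "\<lambda>J. (take k J, drop k J)" and j = "\<lambda>(J1, J2). J1 @ J2"])
      (use assms in \<open>auto simp: index_lists_def dest: in_set_takeD in_set_dropD\<close>)
  finally show ?thesis by simp
qed

text \<open>The matrix acts on every tensor position independently, so at each cut \<open>k\<close>
  both its coefficients and the sum over multi-indices factor.\<close>

lemma tensor_action_tensor_prod:
  "tensor_action m A (tensor_prod S T) = tensor_prod (tensor_action m A S) (tensor_action m A T)"
proof
  fix I :: "nat list"
  let ?l = "length I"
  show "tensor_action m A (tensor_prod S T) I =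
    tensor_prod (tensor_action m A S) (tensor_action m A T) I"
  proof (cases "set I \<subseteq> {..<m}")
    case False
    \<comment> \<open>An index out of range lies in one of the two pieces, whatever the cut, and
      that factor then vanishes by convention.\<close>
    have "tensor_action m A S (take k I) * tensor_action m A T (drop k I) = 0" for k
    proof -
      have "set I = set (take k I) \<union> set (drop k I)"
        by (metis append_take_drop_id set_append)
      then have "\<not> set (take k I) \<subseteq> {..<m} \<or> \<not> set (drop k I) \<subseteq> {..<m}"
        using False by blast
      then show ?thesis by (auto simp: tensor_action_altdef)
    qed
    then have "tensor_prod (tensor_action m A S) (tensor_action m A T) I = 0"
      unfolding tensor_prod_def by (intro sum.neutral) blast
    then show ?thesis
      using False by (simp add: tensor_action_altdef)
  next
    case True
    have prod_split: "(\<Prod>i<?l. A $$ (I ! i, J ! i)) =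
      (\<Prod>i<k. A $$ (take k I ! i, take k J ! i)) *
      (\<Prod>i<?l - k. A $$ (drop k I ! i, drop k J ! i))"
      if "k \<le> ?l" "J \<in> index_lists m ?l" for k J
    proof -
      have "(\<Prod>i<?l. A $$ (I ! i, J ! i)) =
        (\<Prod>i<k. A $$ (I ! i, J ! i)) * (\<Prod>i=k..<?l. A $$ (I ! i, J ! i))"
        using prod.atLeastLessThan_concat[of 0 k ?l "\<lambda>i. A $$ (I ! i, J ! i)"] that(1)
        by (simp add: atLeast0LessThan)
      also have "(\<Prod>i=k..<?l. A $$ (I ! i, J ! i)) = (\<Prod>i<?l - k. A $$ (I ! (k + i), J ! (k + i)))"
        by (rule prod.reindex_bij_witness[where i = "\<lambda>i. k + i" and j = "\<lambda>i. i - k"]) auto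
      also have "(\<Prod>i<k. A $$ (I ! i, J ! i)) = (\<Prod>i<k. A $$ (take k I ! i, take k J ! i))"
        by (intro prod.cong) auto
      also have "(\<Prod>i<?l - k. A $$ (I ! (k + i), J ! (k + i))) =
          (\<Prod>i<?l - k. A $$ (drop k I ! i, drop k J ! i))"
        using that by (intro prod.cong) (auto simp: index_lists_def)
      finally show ?thesis .
    qed
    have sub: "set (take k I) \<subseteq> {..<m}" "set (drop k I) \<subseteq> {..<m}" for k
      using True by (meson set_take_subset set_drop_subset subset_trans)+
    have "tensor_action m A (tensor_prod S T) I =
      (\<Sum>J\<in>index_lists m ?l. \<Sum>k\<le>?l.
        (\<Prod>i<?l. A $$ (I ! i, J ! i)) * (S (take k J) * T (drop k J)))"
      using True by (auto simp: tensor_action_altdef tensor_prod_def sum_distrib_left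
          index_lists_def intro!: sum.cong)
    also have "\<dots> = (\<Sum>k\<le>?l. \<Sum>J\<in>index_lists m ?l.
        (\<Prod>i<?l. A $$ (I ! i, J ! i)) * (S (take k J) * T (drop k J)))"
      by (rule sum.swap)
    \<comment> \<open>Cutting \<open>I\<close> and \<open>J\<close> at the same place separates the
      matrix entries seen by \<open>S\<close> from those seen by \<open>T\<close>.\<close>
    also have "\<dots> = (\<Sum>k\<le>?l. \<Sum>J\<in>index_lists m ?l.
        ((\<Prod>i<k. A $$ (take k I ! i, take k J ! i)) * S (take k J)) *
        ((\<Prod>i<?l - k. A $$ (drop k I ! i, drop k J ! i)) * T (drop k J)))"
      by (intro sum.cong refl) (simp add: prod_split mult_ac del: nth_take nth_drop)
    also have "\<dots> = (\<Sum>k\<le>?l. tensor_action m A S (take k I) * tensor_action m A T (drop k I))"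
    proof (intro sum.cong refl)
      fix k assume "k \<in> {..?l}"
      then have k: "k \<le> ?l" by simp
      show "(\<Sum>J\<in>index_lists m ?l.
        ((\<Prod>i<k. A $$ (take k I ! i, take k J ! i)) * S (take k J)) *
        ((\<Prod>i<?l - k. A $$ (drop k I ! i, drop k J ! i)) * T (drop k J))) =
        tensor_action m A S (take k I) * tensor_action m A T (drop k I)"
        using sum_index_lists_split[OF k, where m = m and
            F = "\<lambda>J. (\<Prod>i<k. A $$ (take k I ! i, J ! i)) * S J" and
            G = "\<lambda>J. (\<Prod>i<?l - k. A $$ (drop k I ! i, J ! i)) * T J"] k sub[of k]
        by (simp add: tensor_action_altdef min_absorb2 del: nth_take nth_drop)
    qed
    finally show ?thesis by (simp add: tensor_prod_def)
  qed
qed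

text \<open>\<open>tensor_prod\<close> runs over all cuts because its arguments may have mixed
  degrees; a left factor of pure degree \<open>k\<close> leaves only the cut at
  \<open>k\<close>.\<close>

lemma tensor_prod_homogeneous:
  assumes "\<And>I. S I \<noteq> 0 \<Longrightarrow> length I = k"
  shows "tensor_prod S T I = S (take k I) * T (drop k I)"
proof (cases "k \<le> length I")
  case True
  have "tensor_prod S T I = (\<Sum>j\<in>{k}. S (take j I) * T (drop j I))"
    unfolding tensor_prod_def
  proof (rule sum.mono_neutral_right)
    show "\<forall>i\<in>{..length I} - {k}. S (take i I) * T (drop i I) = 0"
      using assms[of "take i I" for i] by (force simp: min_absorb2)
  qed (use True in auto)
  then show ?thesis by simp
next
  \<comment> \<open>Every prefix of \<open>I\<close> is now shorter than \<open>k\<close>, so both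
    sides vanish.\<close>
  case False
  then have "S (take j I) = 0" for j
    using assms[of "take j I"] by fastforce
  then show ?thesis by (simp add: tensor_prod_def)
qed

section \<open>Alternating tensors and minors\<close>

lemma wedge_apply:
  "wedge k I = (\<Sum>p | p permutes {..<k}. of_int (sign p) * (if I = map p [0..<k] then 1 else 0))"
proof -
  have "(\<Sum>p\<in>P. F p) I = (\<Sum>p\<in>P. F p I)" for P and F :: "(nat \<Rightarrow> nat) \<Rightarrow> tensor"
    by (induction P rule: infinite_finite_induct) auto
  then show ?thesis by (simp add: wedge_def basis_tensor_def scaleR_fun_def)
qed

lemma permutes_map_upt_inj:
  assumes "p permutes {..<k}" "q permutes {..<k}" "map p [0..<k] = map q [0..<k]"
  shows "p = q"
proof
  fix x
  show "p x = q x"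
  proof (cases "x < k")
    case True
    then show ?thesis using assms(3) by simp
  next
    case False
    then show ?thesis using assms(1,2) by (simp add: permutes_def)
  qed
qed

lemma wedge_permutation:
  assumes "p permutes {..<k}"
  shows "wedge k (map p [0..<k]) = of_int (sign p)"
proof -
  have "wedge k (map p [0..<k]) = (\<Sum>q | q permutes {..<k}. if q = p then of_int (sign p) else 0)"
    unfolding wedge_apply by (rule sum.cong) (use permutes_map_upt_inj assms in auto)
  then show ?thesis
    using assms by (simp add: sum.delta finite_permutations)
qed

lemma wedge_nonzeroD:
  assumes "wedge k I \<noteq> 0"
  obtains p where "p permutes {..<k}" "I = map p [0..<k]"
proof -
  have "\<exists>p. p permutes {..<k} \<and> I = map p [0..<k]"
  proof (rule ccontr)
    assume "\<not> ?thesis"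
    then have "wedge k I = 0"
      unfolding wedge_apply by (intro sum.neutral) auto
    with assms show False by simp
  qed
  then show ?thesis using that by blast
qed

text \<open>This is the Leibniz expansion: the coordinates of the image of a wedge are the minors on
  the first \<open>k\<close> columns, with rows selected by \<open>I\<close>.\<close>

lemma tensor_action_wedge:
  assumes "k \<le> m" "length I = k" "set I \<subseteq> {..<m}"
  shows "tensor_action m A (wedge k) I = det (mat k k (\<lambda>(i, j). A $$ (I ! i, j)))"
proof -
  have mem: "map p [0..<k] \<in> index_lists m k" if "p permutes {..<k}" for p
    using assms(1) permutes_image[OF that] by (auto simp: index_lists_def atLeast0LessThan)
  have "tensor_action m A (wedge k) I =
    (\<Sum>J\<in>index_lists m k. \<Sum>p | p permutes {..<k}.
      (if J = map p [0..<k] then of_int (sign p) * (\<Prod>i<k. A $$ (I ! i, J ! i)) else 0))"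
    using assms by (auto simp: tensor_action_altdef wedge_apply sum_distrib_left intro!: sum.cong)
  also have "\<dots> = (\<Sum>p | p permutes {..<k}. \<Sum>J\<in>index_lists m k.
      (if J = map p [0..<k] then of_int (sign p) * (\<Prod>i<k. A $$ (I ! i, J ! i)) else 0))"
    by (rule sum.swap)
  also have "\<dots> = (\<Sum>p | p permutes {..<k}. of_int (sign p) * (\<Prod>i<k. A $$ (I ! i, p i)))"
    by (intro sum.cong refl) (auto simp: sum.delta mem)
  also have "\<dots> = det (mat k k (\<lambda>(i, j). A $$ (I ! i, j)))"
    unfolding det_def
    by (auto simp: atLeast0LessThan permutes_in_image intro!: sum.cong prod.cong)
  finally show ?thesis .
qed

text \<open>The action preserves the degree, and a repeated entry of \<open>I\<close> produces a
  minor with two equal rows.\<close>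

lemma tensor_action_wedge_support:
  assumes "k \<le> m" "tensor_action m A (wedge k) I \<noteq> 0"
  shows "length I = k" "set I \<subseteq> {..<m}" "distinct I"
proof -
  show sub: "set I \<subseteq> {..<m}"
    using assms(2) by (auto simp: tensor_action_altdef split: if_splits)
  show len: "length I = k"
  proof (rule ccontr)
    assume ne: "length I \<noteq> k"
    have "wedge k J = 0" if "J \<in> index_lists m (length I)" for J
      using that ne wedge_nonzeroD[of k J] by (fastforce simp: index_lists_def)
    then show False using assms(2) by (simp add: tensor_action_altdef split: if_splits)
  qed
  show "distinct I"
  proof (rule ccontr)
    assume "\<not> distinct I"
    then obtain i j where ij: "i < k" "j < k" "i \<noteq> j" "I ! i = I ! j"
      using len by (auto simp: distinct_conv_nth)
    have "det (mat k k (\<lambda>(i, j). A $$ (I ! i, j))) = 0"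
      by (rule det_identical_rows[OF _ ij(3,1,2)]) (use ij in \<open>auto intro!: eq_vecI\<close>)
    then show False
      using assms sub len by (simp add: tensor_action_wedge)
  qed
qed

text \<open>Here the selected rows are the first \<open>k\<close> in permuted order. The sign this
  costs is exactly the coordinate of the wedge itself, so a leading minor factors out.\<close>

lemma tensor_action_wedge_permutation:
  assumes "k \<le> m" "p permutes {..<k}"
  shows "tensor_action m A (wedge k) (map p [0..<k]) =
    det (mat k k (\<lambda>(i, j). A $$ (i, j))) * wedge k (map p [0..<k])"
proof -
  have pk: "p i < k \<longleftrightarrow> i < k" for i
    using permutes_in_image[OF assms(2), of i] by simp
  then have "set (map p [0..<k]) \<subseteq> {..<m}"
    using assms(1) permutes_image[OF assms(2)] by (auto simp: atLeast0LessThan)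
  then have "tensor_action m A (wedge k) (map p [0..<k]) =
      det (mat k k (\<lambda>(i, j). A $$ (map p [0..<k] ! i, j)))"
    using assms by (intro tensor_action_wedge) auto
  also have "mat k k (\<lambda>(i, j). A $$ (map p [0..<k] ! i, j)) =
      mat k k (\<lambda>(i, j). mat k k (\<lambda>(i, j). A $$ (i, j)) $$ (p i, j))"
    by (rule eq_matI) (auto simp: pk)
  also have "det \<dots> = of_int (sign p) * det (mat k k (\<lambda>(i, j). A $$ (i, j)))"
    using assms(2) by (intro det_permute_rows) (auto simp: atLeast0LessThan)
  finally show ?thesis
    using assms by (simp add: wedge_permutation)
qed

text \<open>Exchange argument: the entries of \<open>I\<close> outside \<open>{..<k}\<close> are at
  least \<open>k\<close>, and equally many numbers missing from \<open>I\<close> are at most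
  \<open>k - 1\<close>. Equality leaves nothing to exchange.\<close>

lemma distinct_sum_list:
  fixes I :: "nat list"
  assumes "distinct I" "length I = k"
  shows "\<Sum>{..<k} \<le> sum_list I" "sum_list I = \<Sum>{..<k} \<Longrightarrow> set I = {..<k}"
proof -
  let ?S = "set I"
  have card: "card ?S = k" "sum_list I = \<Sum>?S"
    using assms by (auto simp: distinct_card distinct_sum_list_conv_Sum)
  define c where "c = card (?S - {..<k})"
  have c: "card ({..<k} - ?S) = c"
    using card card_Diff_subset_Int[of ?S "{..<k}"] card_Diff_subset_Int[of "{..<k}" ?S]
    by (simp add: c_def Int_commute)
  have S: "\<Sum>?S = \<Sum>(?S \<inter> {..<k}) + \<Sum>(?S - {..<k})"
    by (metis List.finite_set sum.Int_Diff)
  have K: "\<Sum>{..<k} = \<Sum>(?S \<inter> {..<k}) + \<Sum>({..<k} - ?S)"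
    by (metis Int_commute finite_lessThan sum.Int_Diff)
  have up: "c * k \<le> \<Sum>(?S - {..<k})"
    using sum_bounded_below[of "?S - {..<k}" k "\<lambda>x. x"] by (auto simp: c_def)
  have lo: "\<Sum>({..<k} - ?S) \<le> c * (k - 1)"
    using sum_bounded_above[of "{..<k} - ?S" "\<lambda>x. x" "k - 1"] c by fastforce
  have le: "c * (k - 1) \<le> c * k" by simp
  show "\<Sum>{..<k} \<le> sum_list I"
    using up lo le S K card by linarith
  assume "sum_list I = \<Sum>{..<k}"
  then have eq: "c * (k - 1) = c * k"
    using up lo le S K card by linarith
  have "c = 0"
  proof (rule ccontr)
    assume "c \<noteq> 0"
    \<comment> \<open>With truncated subtraction \<open>k - 1 = k\<close> holds at
      \<open>k = 0\<close>, so this case has to be excluded first.\<close>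
    moreover have "k \<noteq> 0"
      using c \<open>c \<noteq> 0\<close> by (cases "k = 0") auto
    ultimately show False using eq by (cases k) auto
  qed
  then have "?S \<subseteq> {..<k}" by (simp add: c_def)
  then show "?S = {..<k}"
    using card by (intro card_subset_eq) auto
qed

lemma distinct_list_permutation:
  assumes "distinct I" "length I = k" "set I = {..<k}"
  obtains p where "p permutes {..<k}" "I = map p [0..<k]"
proof -
  define p where "p i = (if i < k then I ! i else i)" for i
  have "bij_betw p {..<k} {..<k}"
  proof (rule bij_betw_cong[THEN iffD1])
    show "bij_betw ((!) I) {..<k} {..<k}"
      by (rule bij_betw_nth) (use assms in auto)
  qed (simp add: p_def)
  then have "p permutes {..<k}"
    by (rule bij_imp_permutes) (simp add: p_def)
  moreover have "I = map p [0..<k]"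
    using assms(2) by (intro nth_equalityI) (auto simp: p_def)
  ultimately show ?thesis using that by blast
qed

subsection \<open>Coordinates of the highest tensor\<close>

text \<open>The shape of a highest tensor for an arbitrary list of wedge degrees, which makes
  induction on that list possible.\<close>

definition wedges :: "nat list \<Rightarrow> tensor"
  where "wedges ks = foldr tensor_prod (map wedge ks) (basis_tensor [])"

text \<open>The exponent of 2 by which the diagonal matrix with \<open>j\<close> leading entries 2
  and all others 1 scales the basis tensor of \<open>I\<close>.\<close>

definition count_below :: "nat \<Rightarrow> nat list \<Rightarrow> nat"
  where "count_below j I = length (filter (\<lambda>x. x < j) I)"

text \<open>The index sum shared by all nonzero coordinates of \<open>wedges ks\<close>, and a lower
  bound for the index sums in its images under matrices.\<close>

definition min_weight :: "nat list \<Rightarrow> nat"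
  where "min_weight ks = (\<Sum>k\<leftarrow>ks. \<Sum>{..<k})"

lemma count_below_append [simp]: "count_below j (I @ J) = count_below j I + count_below j J"
  by (simp add: count_below_def)

lemma count_below_distinct:
  assumes "distinct I"
  shows "count_below j I = card (set I \<inter> {..<j})"
proof -
  have "count_below j I = card (set (filter (\<lambda>x. x < j) I))"
    using assms by (simp add: count_below_def distinct_card distinct_filter del: set_filter)
  also have "set (filter (\<lambda>x. x < j) I) = set I \<inter> {..<j}" by auto
  finally show ?thesis .
qed

lemma wedge_supportD:
  assumes "wedge k I \<noteq> 0"
  shows "length I = k" "distinct I" "set I = {..<k}"
proof -
  obtain p where p: "p permutes {..<k}" "I = map p [0..<k]"
    using wedge_nonzeroD[OF assms] .
  show "length I = k" "distinct I" "set I = {..<k}"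
    using p permutes_image[OF p(1)]
    by (auto simp: distinct_map atLeast0LessThan intro: permutes_inj_on)
qed

lemma wedges_Nil: "wedges [] = basis_tensor []"
  by (simp add: wedges_def)

lemma wedges_Cons: "wedges (k # ks) I = wedge k (take k I) * wedges ks (drop k I)"
  using tensor_prod_homogeneous[of "wedge k" k "wedges ks" I] wedge_supportD(1)
  by (simp add: wedges_def)

lemma tensor_action_unit: "tensor_action m A (basis_tensor []) = basis_tensor []"
proof
  fix I :: "nat list"
  show "tensor_action m A (basis_tensor []) I = basis_tensor [] I"
  proof (cases "I = []")
    case True
    moreover have "index_lists m 0 = {[]}" by (auto simp: index_lists_def)
    ultimately show ?thesis by (simp add: tensor_action_altdef basis_tensor_def)
  next
    case False
    then have "(\<Prod>k<length I. A $$ (I ! k, J ! k)) * basis_tensor [] J = 0"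
      if "J \<in> index_lists m (length I)" for J
      using that by (auto simp: index_lists_def basis_tensor_def)
    then have "(\<Sum>J\<in>index_lists m (length I).
        (\<Prod>k<length I. A $$ (I ! k, J ! k)) * basis_tensor [] J) = 0"
      by (intro sum.neutral) blast
    then have "tensor_action m A (basis_tensor []) I = 0"
      by (simp only: tensor_action_altdef if_cancel)
    with False show ?thesis by (simp add: basis_tensor_def)
  qed
qed

lemma tensor_action_wedges_Cons:
  assumes "k \<le> m"
  shows "tensor_action m A (wedges (k # ks)) I =
    tensor_action m A (wedge k) (take k I) * tensor_action m A (wedges ks) (drop k I)"
proof -
  have "tensor_action m A (wedges (k # ks)) =
      tensor_prod (tensor_action m A (wedge k)) (tensor_action m A (wedges ks))"
    by (simp add: wedges_def tensor_action_tensor_prod)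
  then show ?thesis
    using tensor_prod_homogeneous[of "tensor_action m A (wedge k)" k]
      tensor_action_wedge_support(1)[OF assms] by simp
qed

text \<open>A multi-index in the support is a concatenation of blocks, one for each \<open>k\<close>
  in \<open>ks\<close>, each a permutation of \<open>{..<k}\<close>. All the counts add up over the
  blocks.\<close>

lemma wedges_support:
  assumes "wedges ks I \<noteq> 0"
  shows "length I = sum_list ks" "sum_list I = min_weight ks"
    "count_below j I = (\<Sum>k\<leftarrow>ks. min j k)"
    "(\<And>k. k \<in> set ks \<Longrightarrow> k \<le> m) \<Longrightarrow> set I \<subseteq> {..<m}"
proof -
  have "length I = sum_list ks \<and> sum_list I = min_weight ks \<and>
    count_below j I = (\<Sum>k\<leftarrow>ks. min j k) \<and>
    ((\<forall>k\<in>set ks. k \<le> m) \<longrightarrow> set I \<subseteq> {..<m})"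
    using assms
  proof (induction ks arbitrary: I)
    case Nil
    then show ?case
      by (auto simp: wedges_Nil basis_tensor_def min_weight_def count_below_def split: if_splits)
  next
    case (Cons k ks)
    obtain I1 I2 where I: "I = I1 @ I2" "I1 = take k I" "I2 = drop k I" by simp
    have "wedge k I1 \<noteq> 0" and I2: "wedges ks I2 \<noteq> 0"
      using Cons.prems unfolding wedges_Cons I(2,3) by auto
    then have I1: "length I1 = k" "distinct I1" "set I1 = {..<k}"
      using wedge_supportD by auto
    have "count_below j I1 = min j k"
      using I1 count_below_distinct[of I1 j] by (simp add: greaterThan_Int_greaterThan min.commute)
    moreover have "sum_list I1 = \<Sum>{..<k}"
      using I1 by (simp add: distinct_sum_list_conv_Sum)
    ultimately show ?case
      using Cons.IH[OF I2] I1 unfolding I(1) by (auto simp: min_weight_def)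
  qed
  then show "length I = sum_list ks" "sum_list I = min_weight ks"
    "count_below j I = (\<Sum>k\<leftarrow>ks. min j k)"
    "(\<And>k. k \<in> set ks \<Longrightarrow> k \<le> m) \<Longrightarrow> set I \<subseteq> {..<m}" by blast+
qed

lemma wedges_nonzero: "\<exists>I. wedges ks I \<noteq> 0"
proof (induction ks)
  case Nil
  then show ?case by (auto simp: wedges_Nil basis_tensor_def)
next
  case (Cons k ks)
  then obtain I where I: "wedges ks I \<noteq> 0" by blast
  have "wedge k [0..<k] = 1"
    using wedge_permutation[OF permutes_id, of k] by simp
  with I have "wedges (k # ks) ([0..<k] @ I) \<noteq> 0"
    by (simp add: wedges_Cons)
  then show ?case by blast
qed

text \<open>After the action the blocks still have distinct entries but need no longer fill
  \<open>{..<k}\<close>, so the equalities for \<open>wedges ks\<close> weaken to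
  inequalities.\<close>

lemma tensor_action_wedges_support:
  assumes "\<And>k. k \<in> set ks \<Longrightarrow> k \<le> m" "tensor_action m A (wedges ks) I \<noteq> 0"
  shows "length I = sum_list ks" "set I \<subseteq> {..<m}" "min_weight ks \<le> sum_list I"
    "count_below j I \<le> (\<Sum>k\<leftarrow>ks. min j k)"
proof -
  have "length I = sum_list ks \<and> set I \<subseteq> {..<m} \<and> min_weight ks \<le> sum_list I \<and>
    count_below j I \<le> (\<Sum>k\<leftarrow>ks. min j k)"
    using assms
  proof (induction ks arbitrary: I)
    case Nil
    then show ?case
      unfolding wedges_Nil tensor_action_unit
      by (auto simp: basis_tensor_def min_weight_def count_below_def split: if_splits)
  next
    case (Cons k ks)
    obtain I1 I2 where I: "I = I1 @ I2" "I1 = take k I" "I2 = drop k I" by simp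
    have k: "k \<le> m" using Cons.prems(1) by simp
    have nz: "tensor_action m A (wedge k) I1 \<noteq> 0" "tensor_action m A (wedges ks) I2 \<noteq> 0"
      using Cons.prems(2) unfolding tensor_action_wedges_Cons[OF k] I(2,3) by auto
    note I1 = tensor_action_wedge_support[OF k nz(1)]
    \<comment> \<open>The entries below \<open>j\<close> form a subset both of \<open>{..<j}\<close>
      and of the \<open>k\<close> entries of the block.\<close>
    have "count_below j I1 \<le> min j k"
      using card_mono[of "{..<j}" "set I1 \<inter> {..<j}"] card_mono[of "set I1" "set I1 \<inter> {..<j}"] I1
      by (simp add: count_below_distinct distinct_card)
    moreover have "\<Sum>{..<k} \<le> sum_list I1"
      using I1 by (intro distinct_sum_list)
    moreover have "length I2 = sum_list ks \<and> set I2 \<subseteq> {..<m} \<and> min_weight ks \<le> sum_list I2 \<and>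
      count_below j I2 \<le> (\<Sum>k\<leftarrow>ks. min j k)"
      using Cons.prems(1) nz(2) by (intro Cons.IH) auto
    ultimately show ?case
      using I1 unfolding I(1) by (auto simp: min_weight_def)
  qed
  then show "length I = sum_list ks" "set I \<subseteq> {..<m}" "min_weight ks \<le> sum_list I"
    "count_below j I \<le> (\<Sum>k\<leftarrow>ks. min j k)" by blast+
qed

text \<open>Each block has its own lower bound on the index sum, so a minimal total forces every
  contributing block to be minimal. A minimal block is a permutation and yields a leading
  minor.\<close>

lemma tensor_action_wedges_min_weight:
  assumes "\<And>k. k \<in> set ks \<Longrightarrow> k \<le> m" "sum_list I = min_weight ks"
  shows "tensor_action m A (wedges ks) I =
    (\<Prod>k\<leftarrow>ks. det (mat k k (\<lambda>(i, j). A $$ (i, j)))) * wedges ks I"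
  using assms
proof (induction ks arbitrary: I)
  case Nil
  then show ?case by (simp add: wedges_Nil tensor_action_unit)
next
  case (Cons k ks)
  obtain I1 I2 where I: "I = I1 @ I2" "I1 = take k I" "I2 = drop k I" by simp
  have k: "k \<le> m" and ks: "\<And>k. k \<in> set ks \<Longrightarrow> k \<le> m" using Cons.prems(1) by simp_all
  have sum: "sum_list I1 + sum_list I2 = \<Sum>{..<k} + min_weight ks"
    using Cons.prems(2) I(1) by (simp add: min_weight_def)
  let ?d = "\<lambda>k. det (mat k k (\<lambda>(i, j). A $$ (i, j)))"
  have goal: "tensor_action m A (wedges (k # ks)) I =
      tensor_action m A (wedge k) I1 * tensor_action m A (wedges ks) I2"
    "wedges (k # ks) I = wedge k I1 * wedges ks I2"
    unfolding tensor_action_wedges_Cons[OF k] wedges_Cons I(2,3) by (rule refl)+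
  \<comment> \<open>The two sums have a prescribed total: unless both are minimal, one falls below
    its bound, where the factor on each side of the claim vanishes.\<close>
  consider "sum_list I1 < \<Sum>{..<k}" | "sum_list I2 < min_weight ks"
    | "sum_list I1 = \<Sum>{..<k}" "sum_list I2 = min_weight ks"
    using sum by linarith
  then show ?case
  proof cases
    case 1
    have "tensor_action m A (wedge k) I1 = 0"
    proof (rule ccontr)
      assume "tensor_action m A (wedge k) I1 \<noteq> 0"
      then show False
        using tensor_action_wedge_support[OF k] distinct_sum_list(1) 1 by (metis not_less)
    qed
    moreover have "wedge k I1 = 0"
    proof (rule ccontr)
      assume "wedge k I1 \<noteq> 0"
      then show False
        using wedge_supportD distinct_sum_list(1) 1 by (metis not_less)
    qed
    ultimately show ?thesis by (simp add: goal)
  next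
    case 2
    have "tensor_action m A (wedges ks) I2 = 0"
    proof (rule ccontr)
      assume "tensor_action m A (wedges ks) I2 \<noteq> 0"
      then show False
        using tensor_action_wedges_support(3)[of ks m A I2] ks 2 by simp
    qed
    moreover have "wedges ks I2 = 0"
      using wedges_support(2)[of ks I2] 2 by (cases "wedges ks I2 = 0") auto
    ultimately show ?thesis by (simp add: goal)
  next
    case 3
    \<comment> \<open>A block of \<open>k\<close> distinct entries with minimal sum is a permutation
      of \<open>{..<k}\<close>; any other block lies outside both supports.\<close>
    have "tensor_action m A (wedge k) I1 = ?d k * wedge k I1"
    proof (cases "distinct I1 \<and> length I1 = k")
      case True
      then have "set I1 = {..<k}" using distinct_sum_list(2) 3(1) by blast
      with True obtain p where "p permutes {..<k}" "I1 = map p [0..<k]"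
        by (blast elim: distinct_list_permutation)
      then show ?thesis using tensor_action_wedge_permutation[OF k] by simp
    next
      case False
      then have "tensor_action m A (wedge k) I1 = 0" "wedge k I1 = 0"
        using tensor_action_wedge_support[OF k, of A I1] wedge_supportD[of k I1] by blast+
      then show ?thesis by simp
    qed
    moreover have "tensor_action m A (wedges ks) I2 = (\<Prod>k\<leftarrow>ks. ?d k) * wedges ks I2"
      using ks 3(2) by (rule Cons.IH)
    ultimately show ?thesis by (simp add: goal)
  qed
qed

section \<open>Column lengths of a Young diagram, one wedge factor per column\<close>

definition columns :: "nat \<Rightarrow> (nat \<Rightarrow> nat) \<Rightarrow> nat list"
  where "columns m D = concat (map (\<lambda>k. replicate (D k - D (Suc k)) k) [1..<m])"

lemma highest_tensor_eq: "highest_tensor m D = wedges (columns m D)"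
  by (simp add: highest_tensor_def wedges_def columns_def map_concat comp_def)

lemma columns_le: "k \<in> set (columns m D) \<Longrightarrow> k \<le> m"
  by (auto simp: columns_def)

lemma sum_columns:
  fixes f :: "nat \<Rightarrow> nat"
  shows "(\<Sum>k\<leftarrow>columns m D. f k) = (\<Sum>k=1..<m. (D k - D (Suc k)) * f k)"
proof -
  have "(\<Sum>k\<leftarrow>concat (map (\<lambda>k. replicate (D k - D (Suc k)) k) xs). f k) =
      (\<Sum>k\<leftarrow>xs. (D k - D (Suc k)) * f k)" for xs
    by (induction xs) (simp_all add: sum_list_replicate)
  then show ?thesis
    by (simp add: columns_def sum_list_distinct_conv_sum_set)
qed

text \<open>Both sides count the cells in the first \<open>j\<close> rows: a column of length
  \<open>k\<close> has \<open>min j k\<close> of them. Passing to the next row adds one cell for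
  each column longer than \<open>j\<close>.\<close>

lemma sum_columns_min:
  assumes "young_diagram m D" "j \<le> m"
  shows "(\<Sum>k\<leftarrow>columns m D. min j k) = (\<Sum>i=1..j. D i)"
  using assms(2)
proof (induction j)
  case 0
  then show ?case by (simp add: sum_columns)
next
  case (Suc j)
  \<comment> \<open>The natural subtractions are exact because the rows decrease. At
    \<open>m' = m\<close> the boundary term is \<open>D m = 0\<close>, so row \<open>Suc j\<close>
    has as many cells as there are columns reaching it.\<close>
  have tele: "(\<Sum>k=Suc j..<m'. D k - D (Suc k)) + D m' = D (Suc j)" if "Suc j \<le> m'" "m' \<le> m" for m'
    using that
  proof (induction m' rule: dec_induct)
    case (step k)
    have "D (Suc k) \<le> D k"
      using assms(1) step by (simp add: young_diagram_def)
    with step show ?case by simp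
  qed simp
  have Dm: "D m = 0" using assms(1) by (simp add: young_diagram_def)
  have "(\<Sum>k=1..<m. (D k - D (Suc k)) * min (Suc j) k) =
      (\<Sum>k=1..<m. (D k - D (Suc k)) * min j k + (if Suc j \<le> k then D k - D (Suc k) else 0))"
    by (intro sum.cong) (auto simp: min_def not_le le_Suc_eq)
  also have "\<dots> = (\<Sum>k=1..<m. (D k - D (Suc k)) * min j k) + (\<Sum>k=Suc j..<m. D k - D (Suc k))"
  proof -
    have "{1..<m} \<inter> {k. Suc j \<le> k} = {Suc j..<m}" by auto
    then show ?thesis by (simp add: sum.distrib sum.If_cases)
  qed
  finally show ?case
    using Suc tele[of m] Dm by (simp add: sum_columns)
qed

lemma sum_list_columns:
  assumes "young_diagram m D"
  shows "sum_list (columns m D) = (\<Sum>i=1..m. D i)"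
proof -
  have "sum_list (columns m D) = (\<Sum>k\<leftarrow>columns m D. min m k)"
    by (intro arg_cong[where f = sum_list] map_idI[symmetric]) (auto dest: columns_le simp: min_absorb2)
  then show ?thesis using sum_columns_min[OF assms, of m] by simp
qed

subsection \<open>The model space\<close>

lemma det_mat_diag: "det (mat_diag m t) = (\<Prod>i<m. t i)"
  for t :: "nat \<Rightarrow> real"
proof -
  have "det (mat_diag m t) = prod_list (diag_mat (mat_diag m t))"
    by (rule det_upper_triangular[where n = m]) (auto simp: mat_diag_def)
  also have "diag_mat (mat_diag m t) = map t [0..<m]"
    by (auto simp: diag_mat_def mat_diag_def)
  finally show ?thesis
    by (simp add: prod.distinct_set_conv_list[symmetric] atLeast0LessThan)
qed

lemma mat_diag_GL: "(\<And>i. i < m \<Longrightarrow> t i \<noteq> 0) \<Longrightarrow> mat_diag m t \<in> GL m"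
  by (simp add: GL_def det_mat_diag)

lemma tensor_action_mat_diag:
  "tensor_action m (mat_diag m t) T I =
    (if set I \<subseteq> {..<m} then prod_list (map t I) * T I else 0)"
proof (cases "set I \<subseteq> {..<m}")
  case True
  have I: "I \<in> index_lists m (length I)" using True by (simp add: index_lists_def)
  have coeff: "(\<Prod>k<length I. mat_diag m t $$ (I ! k, J ! k)) =
      (if J = I then prod_list (map t I) else 0)" if J: "J \<in> index_lists m (length I)" for J
  proof -
    have entry: "mat_diag m t $$ (I ! k, J ! k) = (if I ! k = J ! k then t (I ! k) else 0)"
      if "k < length I" for k
    proof -
      have "I ! k < m" "J ! k < m"
        using True J that by (auto simp: index_lists_def subset_iff)
      then show ?thesis by (simp add: mat_diag_def)
    qed
    show ?thesis
    proof (cases "J = I")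
      case True
      have "(\<Prod>k<length I. mat_diag m t $$ (I ! k, I ! k)) = (\<Prod>k<length I. t (I ! k))"
        by (intro prod.cong) (use entry True in auto)
      with True show ?thesis
        by (simp add: prod.list_conv_set_nth atLeast0LessThan)
    next
      case False
      then obtain k where "k < length I" "I ! k \<noteq> J ! k"
        using J by (auto simp: index_lists_def list_eq_iff_nth_eq)
      with False entry show ?thesis by (auto intro!: prod_zero)
    qed
  qed
  have "tensor_action m (mat_diag m t) T I =
      (\<Sum>J\<in>index_lists m (length I). if J = I then prod_list (map t I) * T J else 0)"
    unfolding tensor_action_altdef if_P[OF True] by (intro sum.cong refl) (simp add: coeff)
  then show ?thesis
    using True I by (simp add: sum.delta)
qed (simp add: tensor_action_altdef)

text \<open>Adjointness for the standard inner product on coordinates of degree \<open>l\<close>,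
  obtained by exchanging the two summations.\<close>

lemma tensor_action_transpose:
  assumes "A \<in> carrier_mat m m"
  shows "(\<Sum>I\<in>index_lists m l. w I * tensor_action m A T I) =
    (\<Sum>I\<in>index_lists m l. tensor_action m (transpose_mat A) w I * T I)"
proof -
  have "(\<Sum>I\<in>index_lists m l. w I * tensor_action m A T I) =
    (\<Sum>I\<in>index_lists m l. \<Sum>J\<in>index_lists m l. w I * (\<Prod>k<l. A $$ (I ! k, J ! k)) * T J)"
    by (intro sum.cong refl)
      (auto simp: tensor_action_altdef index_lists_def sum_distrib_left mult.assoc)
  also have "\<dots> = (\<Sum>J\<in>index_lists m l. \<Sum>I\<in>index_lists m l. w I * (\<Prod>k<l. A $$ (I ! k, J ! k)) * T J)"
    by (rule sum.swap)
  also have "\<dots> = (\<Sum>J\<in>index_lists m l. tensor_action m (transpose_mat A) w J * T J)"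
  proof (intro sum.cong refl)
    fix J assume J: "J \<in> index_lists m l"
    have "(\<Prod>k<l. A $$ (I ! k, J ! k)) = (\<Prod>k<l. transpose_mat A $$ (J ! k, I ! k))"
      if "I \<in> index_lists m l" for I
      using assms J that by (intro prod.cong) (auto simp: index_lists_def subset_iff)
    then have "(\<Sum>I\<in>index_lists m l. w I * (\<Prod>k<l. A $$ (I ! k, J ! k)) * T J) =
        (\<Sum>I\<in>index_lists m l. (\<Prod>k<l. transpose_mat A $$ (J ! k, I ! k)) * w I * T J)"
      by (intro sum.cong) auto
    moreover have "set J \<subseteq> {..<m}" "length J = l" using J by (auto simp: index_lists_def)
    ultimately show "(\<Sum>I\<in>index_lists m l. w I * (\<Prod>k<l. A $$ (I ! k, J ! k)) * T J) =
        tensor_action m (transpose_mat A) w J * T J"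
      by (simp add: tensor_action_altdef sum_distrib_right)
  qed
  finally show ?thesis .
qed

section \<open>Supports of the tensors in the model space\<close>

lemma tensor_action_highest_support:
  assumes "young_diagram m D" "tensor_action m A (highest_tensor m D) I \<noteq> 0"
  shows "I \<in> index_lists m (\<Sum>i=1..m. D i)"
    "j \<le> m \<Longrightarrow> count_below j I \<le> (\<Sum>i=1..j. D i)"
  using tensor_action_wedges_support(1,2)[of "columns m D" m A I, OF columns_le[where D = D]]
    tensor_action_wedges_support(4)[of "columns m D" m A I j, OF columns_le[where D = D]]
    sum_list_columns[OF assms(1)] sum_columns_min[OF assms(1), of j] assms(2)
  by (auto simp: highest_tensor_eq index_lists_def)

lemma highest_tensor_support:
  assumes "young_diagram m D" "highest_tensor m D I \<noteq> 0"
  shows "I \<in> index_lists m (\<Sum>i=1..m. D i)"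
    "j \<le> m \<Longrightarrow> count_below j I = (\<Sum>i=1..j. D i)"
    "sum_list I = min_weight (columns m D)"
  using wedges_support[of "columns m D" I] columns_le
    sum_list_columns[OF assms(1)] sum_columns_min[OF assms(1), of j] assms(2)
  by (auto simp: highest_tensor_eq index_lists_def)

lemma highest_tensor_nonzero: "highest_tensor m D \<noteq> 0"
  using wedges_nonzero[of "columns m D"] by (auto simp: highest_tensor_eq)

lemma highest_tensor_in_model_space:
  assumes "young_diagram m D"
  shows "highest_tensor m D \<in> model_space m D"
proof -
  \<comment> \<open>The identity matrix is written as a diagonal matrix so that the formula for
    diagonal actions applies.\<close>
  have "tensor_action m (mat_diag m (\<lambda>_. 1)) (highest_tensor m D) I = highest_tensor m D I" for I
    using highest_tensor_support(1)[OF assms, of I]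
    unfolding tensor_action_mat_diag by (auto simp: index_lists_def map_replicate_const)
  then have "highest_tensor m D = tensor_action m (mat_diag m (\<lambda>_. 1)) (highest_tensor m D)"
    by (intro ext) simp
  moreover have "mat_diag m (\<lambda>_. 1) \<in> GL m" by (rule mat_diag_GL) simp
  ultimately show ?thesis
    unfolding model_space_def by (blast intro: span_base)
qed

text \<open>Vanishing outside a fixed set of multi-indices is a linear condition, so the bounds pass
  from the orbit to its span.\<close>

lemma model_space_support:
  assumes "young_diagram m D" "x \<in> model_space m D" "x I \<noteq> 0"
  shows "I \<in> index_lists m (\<Sum>i=1..m. D i)"
    "j \<le> m \<Longrightarrow> count_below j I \<le> (\<Sum>i=1..j. D i)"
proof -
  let ?P = "\<lambda>I. I \<in> index_lists m (\<Sum>i=1..m. D i) \<and>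
    (j \<le> m \<longrightarrow> count_below j I \<le> (\<Sum>i=1..j. D i))"
  have "x \<in> span ((\<lambda>A. tensor_action m A (highest_tensor m D)) ` GL m)"
    using assms(2) by (simp add: model_space_def)
  then have "\<forall>I. x I \<noteq> 0 \<longrightarrow> ?P I"
  proof (rule span_induct)
    show "subspace {x::tensor. \<forall>I. x I \<noteq> 0 \<longrightarrow> ?P I}"
      unfolding subspace_def scaleR_fun_def mem_Collect_eq
    proof (intro conjI ballI allI impI)
      fix x y :: tensor and I
      assume "x \<in> {x. \<forall>I. x I \<noteq> 0 \<longrightarrow> ?P I}" "y \<in> {x. \<forall>I. x I \<noteq> 0 \<longrightarrow> ?P I}" "(x + y) I \<noteq> 0"
      then have "?P I" by (cases "x I = 0") auto
      then show "I \<in> index_lists m (\<Sum>i=1..m. D i)"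
        "j \<le> m \<Longrightarrow> count_below j I \<le> (\<Sum>i=1..j. D i)" by auto
    qed auto
  next
    fix y assume "y \<in> (\<lambda>A. tensor_action m A (highest_tensor m D)) ` GL m"
    then show "\<forall>I. y I \<noteq> 0 \<longrightarrow> ?P I"
      using tensor_action_highest_support[OF assms(1)] by blast
  qed
  then show "I \<in> index_lists m (\<Sum>i=1..m. D i)"
    "j \<le> m \<Longrightarrow> count_below j I \<le> (\<Sum>i=1..j. D i)"
    using assms(3) by blast+
qed

text \<open>The component of least index sum is at most one-dimensional. On the orbit the factor
  \<open>c\<close> is a product of leading minors, and proportionality to a fixed tensor survives
  linear combinations.\<close>

lemma model_space_min_weight:
  assumes "x \<in> model_space m D"
  shows "\<exists>c. \<forall>I. sum_list I = min_weight (columns m D) \<longrightarrow> x I = c * highest_tensor m D I"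
proof -
  let ?P = "\<lambda>x::tensor. \<exists>c. \<forall>I. sum_list I = min_weight (columns m D) \<longrightarrow>
    x I = c * highest_tensor m D I"
  have "x \<in> span ((\<lambda>A. tensor_action m A (highest_tensor m D)) ` GL m)"
    using assms by (simp add: model_space_def)
  then show "?P x"
  proof (rule span_induct)
    have "?P (x + y)" if xy: "?P x" "?P y" for x y
    proof -
      obtain c d where "\<forall>I. sum_list I = min_weight (columns m D) \<longrightarrow> x I = c * highest_tensor m D I"
        "\<forall>I. sum_list I = min_weight (columns m D) \<longrightarrow> y I = d * highest_tensor m D I"
        using xy by blast
      then show ?thesis
        by (intro exI[of _ "c + d"]) (auto simp: algebra_simps)
    qed
    moreover have "?P (a *\<^sub>R x)" if x: "?P x" for a x
    proof -
      obtain c where "\<forall>I. sum_list I = min_weight (columns m D) \<longrightarrow> x I = c * highest_tensor m D I"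
        using x by blast
      then show ?thesis
        by (intro exI[of _ "a * c"]) (auto simp: scaleR_fun_def)
    qed
    moreover have "?P 0" by (rule exI[of _ 0]) simp
    ultimately show "subspace {x. ?P x}"
      unfolding subspace_def mem_Collect_eq by blast
  next
    fix y assume "y \<in> (\<lambda>A. tensor_action m A (highest_tensor m D)) ` GL m"
    then show "?P y"
      using tensor_action_wedges_min_weight[of "columns m D" m, OF columns_le[where D = D]]
      by (auto simp: highest_tensor_eq)
  qed
qed

subsection \<open>Irreducibility\<close>

lemma representation_subspace: "representation m V \<rho> \<Longrightarrow> subspace V"
  by (simp add: representation_def)

lemma representation_closed: "representation m V \<rho> \<Longrightarrow> A \<in> GL m \<Longrightarrow> x \<in> V \<Longrightarrow> \<rho> A x \<in> V"
  by (simp add: representation_def)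

lemma representation_add:
  "representation m V \<rho> \<Longrightarrow> A \<in> GL m \<Longrightarrow> x \<in> V \<Longrightarrow> y \<in> V \<Longrightarrow> \<rho> A (x + y) = \<rho> A x + \<rho> A y"
  by (simp add: representation_def)

lemma representation_scale:
  "representation m V \<rho> \<Longrightarrow> A \<in> GL m \<Longrightarrow> x \<in> V \<Longrightarrow> \<rho> A (c *\<^sub>R x) = c *\<^sub>R \<rho> A x"
  by (simp add: representation_def)

lemma representation_zero:
  assumes "representation m V \<rho>" "A \<in> GL m"
  shows "\<rho> A 0 = 0"
  using representation_scale[OF assms, of 0 0] subspace_0[OF representation_subspace[OF assms(1)]]
  by simp

lemma subrepresentation:
  assumes "representation m V \<rho>" "W \<subseteq> V" "subspace W" "\<And>A x. A \<in> GL m \<Longrightarrow> x \<in> W \<Longrightarrow> \<rho> A x \<in> W"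
  shows "representation m W \<rho>"
  using assms unfolding representation_def by (meson subsetD)

lemma irreducible_rep_isomorphic:
  assumes irr: "irreducible_rep m U \<sigma>" and iso: "isomorphic_reps m U \<sigma> V \<rho>"
  shows "irreducible_rep m V \<rho>"
proof -
  obtain f where f: "linear f" "bij_betw f U V"
    "\<And>A x. A \<in> GL m \<Longrightarrow> x \<in> U \<Longrightarrow> f (\<sigma> A x) = \<rho> A (f x)"
    using iso by (auto simp: isomorphic_reps_def)
  have U: "representation m U \<sigma>" and V: "representation m V \<rho>"
    using iso by (auto simp: isomorphic_reps_def)
  have fUV: "f ` U = V" and inj: "inj_on f U"
    using f(2) by (auto simp: bij_betw_def)
  have U0: "0 \<in> U" using representation_subspace[OF U] subspace_0 by blast
  have "V \<noteq> {0}"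
  proof
    assume V0: "V = {0}"
    have "x = 0" if "x \<in> U" for x
    proof -
      have "f x = f 0" using that fUV V0 linear_0[OF f(1)] by auto
      then show ?thesis using inj that U0 by (simp add: inj_on_eq_iff)
    qed
    then show False using irr U0 by (auto simp: irreducible_rep_def)
  qed
  moreover have "W = {0} \<or> W = V" if W: "W \<subseteq> V" "representation m W \<rho>" for W
  proof -
    \<comment> \<open>The subrepresentation is pulled back to \<open>U\<close>. The restriction to
      \<open>U\<close> matters, since \<open>f\<close> is linear on the whole type but bijective and
      equivariant only there.\<close>
    define W' where "W' = {x \<in> U. f x \<in> W}"
    have WS: "subspace W" using W(2) by (rule representation_subspace)
    have "subspace (U \<inter> f -` W)"
      using WS f(1) representation_subspace[OF U] by (intro subspace_inter linear_subspace_vimage)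
    then have "subspace W'" by (simp add: W'_def vimage_def Int_def)
    moreover have "\<sigma> A x \<in> W'" if "A \<in> GL m" "x \<in> W'" for A x
      using that f(3) representation_closed[OF U] representation_closed[OF W(2)]
      by (auto simp: W'_def)
    ultimately have "representation m W' \<sigma>"
      by (intro subrepresentation[OF U]) (auto simp: W'_def)
    moreover have "W' \<subseteq> U" by (auto simp: W'_def)
    ultimately consider "W' = {0}" | "W' = U"
      using irr unfolding irreducible_rep_def by metis
    then show ?thesis
    proof cases
      case 1
      have "y = 0" if y: "y \<in> W" for y
      proof -
        obtain x where x: "x \<in> U" "y = f x" using y W(1) fUV by blast
        then have "x \<in> W'" using y by (simp add: W'_def)
        with x 1 show ?thesis using linear_0[OF f(1)] by simp
      qed
      then show ?thesis using subspace_0[OF WS] by blast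
    next
      case 2
      then show ?thesis using W(1) fUV by (auto simp: W'_def)
    qed
  qed
  ultimately show ?thesis using V by (auto simp: irreducible_rep_def)
qed

text \<open>The determinant factor is a nonzero scalar and can be divided out, so the twist by
  \<open>n\<close> does not affect invariance of subspaces.\<close>

lemma subrep_tensor_action:
  assumes "representation m W (model_action m n 0)" "A \<in> GL m" "x \<in> W"
  shows "tensor_action m A x \<in> W"
proof -
  define c where "c = \<bar>det A\<bar> powr (-0) * (det A) powi n"
  have "c \<noteq> 0" using assms(2) by (auto simp: GL_def c_def)
  have "c *\<^sub>R tensor_action m A x \<in> W"
    using representation_closed[OF assms] unfolding model_action_def c_def .
  then have "inverse c *\<^sub>R (c *\<^sub>R tensor_action m A x) \<in> W"
    by (rule subspace_scale[OF representation_subspace[OF assms(1)]])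
  then show ?thesis using \<open>c \<noteq> 0\<close> by simp
qed

text \<open>The matrix \<open>diag(2^i)\<close> multiplies the coordinate at \<open>I\<close> by
  \<open>2 ^ sum_list I\<close>. The tensor in the conclusion is the polynomial in this operator
  with roots \<open>2 ^ s\<close>, \<open>s\<close> in \<open>F\<close>, applied to
  \<open>w\<close>.\<close>

lemma subrep_weight_polynomial:
  assumes W: "representation m W (model_action m n 0)"
    and w: "w \<in> W" "\<And>I. w I \<noteq> 0 \<Longrightarrow> set I \<subseteq> {..<m}" and "finite F"
  shows "(\<lambda>I. (\<Prod>s\<in>F. 2 ^ sum_list I - 2 ^ s) * w I) \<in> W"
  using \<open>finite F\<close>
proof (induction F)
  case empty
  then show ?case using w(1) by simp
next
  case (insert s F)
  let ?y = "\<lambda>I. (\<Prod>s\<in>F. 2 ^ sum_list I - 2 ^ s) * w I"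
  let ?A = "mat_diag m (\<lambda>i. 2 ^ i)"
  have pl: "prod_list (map (\<lambda>i. 2 ^ i) I) = (2 ^ sum_list I :: real)" for I
    by (induction I) (simp_all add: power_add)
  have "tensor_action m ?A ?y \<in> W"
    by (rule subrep_tensor_action[OF W _ insert.IH]) (simp add: mat_diag_GL)
  moreover have "2 ^ s *\<^sub>R ?y \<in> W"
    using subspace_scale[OF representation_subspace[OF W] insert.IH] by simp
  ultimately have "tensor_action m ?A ?y - 2 ^ s *\<^sub>R ?y \<in> W"
    by (rule subspace_diff[OF representation_subspace[OF W]])
  moreover have "tensor_action m ?A ?y - 2 ^ s *\<^sub>R ?y =
      (\<lambda>I. (\<Prod>s\<in>insert s F. 2 ^ sum_list I - 2 ^ s) * w I)"
  proof
    fix I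
    show "(tensor_action m ?A ?y - 2 ^ s *\<^sub>R ?y) I =
      (\<Prod>s\<in>insert s F. 2 ^ sum_list I - 2 ^ s) * w I"
    proof (cases "w I = 0")
      case True
      then show ?thesis by (simp add: tensor_action_mat_diag scaleR_fun_def)
    next
      case False
      then show ?thesis
        using w(2)[of I] insert.hyps
        by (simp add: tensor_action_mat_diag scaleR_fun_def pl algebra_simps)
    qed
  qed
  ultimately show ?case by simp
qed

lemma irreducible_model_space:
  assumes D: "young_diagram m D" and U: "representation m (model_space m D) (model_action m n 0)"
  shows "irreducible_rep m (model_space m D) (model_action m n 0)"
proof -
  let ?U = "model_space m D" and ?h = "highest_tensor m D"
  define d where "d = (\<Sum>i=1..m. D i)"
  define s0 where "s0 = min_weight (columns m D)"
  have h_supp: "I \<in> index_lists m d" "sum_list I = s0" if "?h I \<noteq> 0" for I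
    using highest_tensor_support[OF D that] by (auto simp: d_def s0_def)
  have supp: "I \<in> index_lists m d" if "x \<in> ?U" "x I \<noteq> 0" for x I
    using model_space_support[OF D that] by (simp add: d_def)
  have "W = {0} \<or> W = ?U" if W: "W \<subseteq> ?U" "representation m W (model_action m n 0)" for W
  proof (cases "\<exists>w\<in>W. (\<Sum>I\<in>index_lists m d. w I * ?h I) \<noteq> 0")
    case False
    have "w = 0" if w: "w \<in> W" for w
    proof -
      \<comment> \<open>Moving the matrix to the other side by transposition extends orthogonality
        from the highest tensor to its orbit, and then to the span.\<close>
      have "(\<Sum>I\<in>index_lists m d. w I * u I) = 0" if "u \<in> ?U" for u
      proof -
        have "u \<in> span ((\<lambda>A. tensor_action m A ?h) ` GL m)"
          using that by (simp add: model_space_def)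
        then show ?thesis
        proof (rule span_induct)
          show "subspace {u::tensor. (\<Sum>I\<in>index_lists m d. w I * u I) = 0}"
            unfolding subspace_def
          proof (intro conjI ballI allI)
            fix x :: tensor and a :: real
            assume x: "x \<in> {u. (\<Sum>I\<in>index_lists m d. w I * u I) = 0}"
            have "(\<Sum>I\<in>index_lists m d. w I * (a *\<^sub>R x) I) =
                a * (\<Sum>I\<in>index_lists m d. w I * x I)"
              by (simp add: scaleR_fun_def sum_distrib_left mult.left_commute)
            with x show "a *\<^sub>R x \<in> {u. (\<Sum>I\<in>index_lists m d. w I * u I) = 0}" by simp
          qed (simp_all add: distrib_left sum.distrib)
        next
          fix u assume "u \<in> (\<lambda>A. tensor_action m A ?h) ` GL m"
          then obtain A where A: "A \<in> GL m" "u = tensor_action m A ?h" by blast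
          then have "transpose_mat A \<in> GL m" by (auto simp: GL_def det_transpose)
          then have "tensor_action m (transpose_mat A) w \<in> W"
            using subrep_tensor_action[OF W(2)] w by blast
          then have "(\<Sum>I\<in>index_lists m d. tensor_action m (transpose_mat A) w I * ?h I) = 0"
            using False by blast
          then show "(\<Sum>I\<in>index_lists m d. w I * u I) = 0"
            using A tensor_action_transpose[of A m w ?h d] by (simp add: GL_def)
        qed
      qed
      \<comment> \<open>Since \<open>W\<close> lies in the model space, \<open>w\<close> is
        orthogonal to itself.\<close>
      then have "(\<Sum>I\<in>index_lists m d. w I * w I) = 0" using w W(1) by blast
      then have "\<forall>I\<in>index_lists m d. w I * w I = 0"
        by (subst (asm) sum_nonneg_eq_0_iff) auto
      then show ?thesis using supp[of w] w W(1) by (auto simp: fun_eq_iff)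
    qed
    then show ?thesis using subspace_0[OF representation_subspace[OF W(2)]] by blast
  next
    case True
    then obtain w where w: "w \<in> W" "(\<Sum>I\<in>index_lists m d. w I * ?h I) \<noteq> 0" by blast
    have wU: "w \<in> ?U" using w(1) W(1) by blast
    obtain c where c: "\<And>I. sum_list I = s0 \<Longrightarrow> w I = c * ?h I"
      using model_space_min_weight[OF wU] by (auto simp: s0_def)
    \<comment> \<open>Only coordinates of index sum \<open>s0\<close> enter the inner product with
      the highest tensor, and there \<open>w\<close> is \<open>c\<close> times that tensor.\<close>
    have "c \<noteq> 0"
    proof
      assume "c = 0"
      then have "w I * ?h I = 0" for I using c h_supp(2)[of I] by auto
      then have "(\<Sum>I\<in>index_lists m d. w I * ?h I) = 0" by (intro sum.neutral) blast
      then show False using w(2) by contradiction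
    qed
    \<comment> \<open>Taking all other possible index sums as roots kills every component of
      \<open>w\<close> except the minimal one, which is scaled by the nonzero
      \<open>K\<close>.\<close>
    define F where "F = sum_list ` index_lists m d - {s0}"
    define K where "K = (\<Prod>s\<in>F. 2 ^ s0 - 2 ^ s :: real)"
    have "finite F" by (simp add: F_def)
    then have "K \<noteq> 0" by (auto simp: K_def F_def)
    have "(\<lambda>I. (\<Prod>s\<in>F. 2 ^ sum_list I - 2 ^ s) * w I) \<in> W"
      using supp[OF wU] \<open>finite F\<close>
      by (intro subrep_weight_polynomial[OF W(2) w(1)]) (auto simp: index_lists_def)
    also have "(\<lambda>I. (\<Prod>s\<in>F. 2 ^ sum_list I - 2 ^ s) * w I) = (K * c) *\<^sub>R ?h"
    proof
      fix I
      show "(\<Prod>s\<in>F. 2 ^ sum_list I - 2 ^ s) * w I = ((K * c) *\<^sub>R ?h) I"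
      proof (cases "sum_list I = s0")
        case True
        then show ?thesis by (simp add: c scaleR_fun_def K_def)
      next
        case False
        then have "?h I = 0" using h_supp(2) by blast
        moreover have "(\<Prod>s\<in>F. 2 ^ sum_list I - 2 ^ s) = (0::real)" if "w I \<noteq> 0"
          using supp[OF wU that] False \<open>finite F\<close> by (auto simp: F_def intro!: prod_zero)
        ultimately show ?thesis by (cases "w I = 0") (auto simp: scaleR_fun_def)
      qed
    qed
    finally have "inverse (K * c) *\<^sub>R ((K * c) *\<^sub>R ?h) \<in> W"
      by (rule subspace_scale[OF representation_subspace[OF W(2)]])
    moreover have "inverse (K * c) * (K * c) = 1"
      using \<open>K \<noteq> 0\<close> \<open>c \<noteq> 0\<close> by (intro left_inverse) simp
    ultimately have "?h \<in> W" by (simp only: scaleR_scaleR scaleR_one)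
    then have "(\<lambda>A. tensor_action m A ?h) ` GL m \<subseteq> W"
      using subrep_tensor_action[OF W(2)] by blast
    then have "?U \<subseteq> W"
      unfolding model_space_def by (rule span_minimal[OF _ representation_subspace[OF W(2)]])
    then show ?thesis using W(1) by blast
  qed
  moreover have "?U \<noteq> {0}"
    using highest_tensor_in_model_space[OF D] highest_tensor_nonzero by blast
  ultimately show ?thesis using U by (auto simp: irreducible_rep_def)
qed

lemma characterized_by_irreducible:
  assumes "characterized_by m V \<rho> D n 0"
  shows "irreducible_rep m V \<rho>"
proof (rule irreducible_rep_isomorphic)
  show "isomorphic_reps m (model_space m D) (model_action m n 0) V \<rho>"
    using assms by (simp add: characterized_by_def)
  then show "irreducible_rep m (model_space m D) (model_action m n 0)"
    using assms by (intro irreducible_model_space) (auto simp: characterized_by_def isomorphic_reps_def)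
qed

subsection \<open>Weights\<close>

text \<open>With \<open>j\<close> leading entries 2, the eigenvalues record partial sums of weights,
  the quantities compared by dominance; powers of 2 determine their exponents.\<close>

definition torus :: "nat \<Rightarrow> nat \<Rightarrow> real mat"
  where "torus m j = mat_diag m (\<lambda>i. if i < j then 2 else 1)"

text \<open>Cut off at \<open>m\<close>, so that it is determined as a function by the values for \<open>j \<le> m\<close>.\<close>

definition weight_sums :: "nat \<Rightarrow> (nat \<Rightarrow> nat) \<Rightarrow> int \<Rightarrow> nat \<Rightarrow> int"
  where "weight_sums m D n j = (if j \<le> m then int j * n + int (\<Sum>i=1..j. D i) else 0)"

lemma torus_GL [simp]: "torus m j \<in> GL m"
  unfolding torus_def by (rule mat_diag_GL) simp

lemma model_action_torus:
  assumes "j \<le> m" "set I \<subseteq> {..<m}"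
  shows "model_action m n 0 (torus m j) T I = 2 powi (int j * n + int (count_below j I)) * T I"
proof -
  have "{..<m} \<inter> {i. i < j} = {..<j}" using assms(1) by auto
  then have det: "det (torus m j) = 2 ^ j"
    by (simp add: torus_def det_mat_diag prod.If_cases)
  have "prod_list (map (\<lambda>i. if i < j then 2 else 1) I) = (2 ^ count_below j I :: real)"
    by (induction I) (simp_all add: count_below_def)
  then have "tensor_action m (torus m j) T I = 2 ^ count_below j I * T I"
    using assms(2) by (simp add: torus_def tensor_action_mat_diag)
  then show ?thesis
    by (simp add: model_action_def det scaleR_fun_def power_int_add power_int_mult)
qed

lemma model_action_torus_highest:
  assumes D: "young_diagram m D" and j: "j \<le> m"
  shows "model_action m n 0 (torus m j) (highest_tensor m D) =
    2 powi weight_sums m D n j *\<^sub>R highest_tensor m D"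
proof
  fix I
  let ?h = "highest_tensor m D"
  show "model_action m n 0 (torus m j) ?h I = (2 powi weight_sums m D n j *\<^sub>R ?h) I"
  proof (cases "?h I = 0")
    case True
    then show ?thesis
      by (simp add: model_action_def torus_def tensor_action_mat_diag scaleR_fun_def)
  next
    case False
    then show ?thesis
      using highest_tensor_support(1)[OF D False] highest_tensor_support(2)[OF D False j] j
      by (simp add: model_action_torus weight_sums_def scaleR_fun_def index_lists_def)
  qed
qed

text \<open>Any single nonzero coordinate \<open>I\<close> of \<open>y\<close> reveals all exponents
  at once, since each basis tensor is itself an eigenvector. The support bounds of the model space
  then give dominance.\<close>

lemma torus_eigenvector_weight:
  assumes D: "young_diagram m D" and y: "y \<in> model_space m D" "y \<noteq> 0"
    and eig: "\<And>j. j \<le> m \<Longrightarrow> model_action m n 0 (torus m j) y = 2 powi e j *\<^sub>R y"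
  shows "\<exists>I\<in>index_lists m (\<Sum>i=1..m. D i). \<forall>j\<le>m.
    e j = int j * n + int (count_below j I) \<and> e j \<le> weight_sums m D n j"
proof -
  obtain I where I: "y I \<noteq> 0" using y(2) by (auto simp: fun_eq_iff)
  note supp = model_space_support[OF D y(1) I]
  have e: "e j = int j * n + int (count_below j I)" if "j \<le> m" for j
  proof -
    have "set I \<subseteq> {..<m}" using supp(1) by (simp add: index_lists_def)
    then have "2 powi (int j * n + int (count_below j I)) * y I = 2 powi e j * y I"
      using fun_cong[OF eig[OF that], of I] model_action_torus[OF that]
      by (simp add: scaleR_fun_def)
    then have "(2::real) powi (int j * n + int (count_below j I)) = 2 powi e j"
      using I by simp
    then show ?thesis
      using power_int_strict_increasing[of "e j" "int j * n + int (count_below j I)" "2::real"]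
        power_int_strict_increasing[of "int j * n + int (count_below j I)" "e j" "2::real"]
      by (metis less_irrefl linorder_neqE one_less_numeral_iff semiring_norm(76))
  qed
  moreover have "e j \<le> weight_sums m D n j" if "j \<le> m" for j
    using e[OF that] supp(2)[OF that] that by (simp add: weight_sums_def flip: of_nat_sum)
  ultimately show ?thesis using supp(1) by blast
qed

text \<open>The vector is the image of the highest tensor under the isomorphism from the
  model.\<close>

lemma characterized_by_eigenvector:
  assumes "characterized_by m V \<rho> D n 0"
  obtains x where "x \<in> V" "x \<noteq> 0"
    "\<And>j. j \<le> m \<Longrightarrow> \<rho> (torus m j) x = 2 powi weight_sums m D n j *\<^sub>R x"
proof -
  let ?U = "model_space m D" and ?h = "highest_tensor m D"
  have D: "young_diagram m D" using assms by (simp add: characterized_by_def)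
  obtain f where f: "linear f" "bij_betw f ?U V"
    "\<And>A x. A \<in> GL m \<Longrightarrow> x \<in> ?U \<Longrightarrow> f (model_action m n 0 A x) = \<rho> A (f x)"
    using assms by (auto simp: characterized_by_def isomorphic_reps_def)
  have h: "?h \<in> ?U" using D by (rule highest_tensor_in_model_space)
  have "0 \<in> ?U" by (simp add: model_space_def span_zero)
  then have "f ?h \<noteq> 0"
    using f(2) h highest_tensor_nonzero[of m D] linear_0[OF f(1)]
    by (metis bij_betw_inv_into_left)
  moreover have "\<rho> (torus m j) (f ?h) = 2 powi weight_sums m D n j *\<^sub>R f ?h" if "j \<le> m" for j
    using f(3)[OF torus_GL h, of j] model_action_torus_highest[OF D that] linear_scale[OF f(1)]
    by simp
  moreover have "f ?h \<in> V" using f(2) h by (auto simp: bij_betw_def)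
  ultimately show ?thesis using that by blast
qed

text \<open>The eigenvector is pulled back to the model space, where the isomorphism is injective,
  and its weight is read off there.\<close>

lemma characterized_by_eigenvector_weight:
  assumes "characterized_by m V \<rho> D n 0" and x: "x \<in> V" "x \<noteq> 0"
    and eig: "\<And>j. j \<le> m \<Longrightarrow> \<rho> (torus m j) x = 2 powi e j *\<^sub>R x"
  shows "\<exists>I\<in>index_lists m (\<Sum>i=1..m. D i). \<forall>j\<le>m.
    e j = int j * n + int (count_below j I) \<and> e j \<le> weight_sums m D n j"
proof -
  let ?U = "model_space m D"
  have D: "young_diagram m D" using assms by (simp add: characterized_by_def)
  have U: "representation m ?U (model_action m n 0)"
    using assms by (simp add: characterized_by_def isomorphic_reps_def)
  obtain f where f: "linear f" "bij_betw f ?U V"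
    "\<And>A x. A \<in> GL m \<Longrightarrow> x \<in> ?U \<Longrightarrow> f (model_action m n 0 A x) = \<rho> A (f x)"
    using assms by (auto simp: characterized_by_def isomorphic_reps_def)
  obtain y where y: "y \<in> ?U" "x = f y" using f(2) x(1) by (auto simp: bij_betw_def)
  have "y \<noteq> 0" using x(2) y linear_0[OF f(1)] by auto
  moreover have "model_action m n 0 (torus m j) y = 2 powi e j *\<^sub>R y" if j: "j \<le> m" for j
  proof -
    have "f (model_action m n 0 (torus m j) y) = f (2 powi e j *\<^sub>R y)"
      using f(3)[OF torus_GL y(1)] eig[OF j] y(2) linear_scale[OF f(1)] by simp
    moreover have "model_action m n 0 (torus m j) y \<in> ?U"
      using representation_closed[OF U torus_GL y(1)] .
    moreover have "2 powi e j *\<^sub>R y \<in> ?U"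
      using representation_subspace[OF U] y(1) by (rule subspace_scale)
    ultimately show ?thesis
      using f(2) unfolding bij_betw_def by (blast dest: inj_onD)
  qed
  ultimately show ?thesis by (rule torus_eigenvector_weight[OF D y(1)])
qed

text \<open>Consecutive differences recover \<open>n + D i\<close> for \<open>i\<close> from 1 to
  \<open>m\<close>; the last one is \<open>n\<close> because \<open>D m = 0\<close>.\<close>

lemma weight_sums_inject:
  assumes "young_diagram m D" "young_diagram m D'" "2 \<le> m"
    and "\<And>j. j \<le> m \<Longrightarrow> weight_sums m D n j = weight_sums m D' n' j"
  shows "D = D'" "n = n'"
proof -
  have step: "n + int (D i) = n' + int (D' i)" if i: "1 \<le> i" "i \<le> m" for i
  proof -
    obtain k where "i = Suc k" using i(1) by (cases i) auto
    then show ?thesis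
      using assms(4)[of k] assms(4)[of "Suc k"] i
      by (simp add: weight_sums_def algebra_simps)
  qed
  have "D m = 0" "D' m = 0" using assms(1,2) by (auto simp: young_diagram_def)
  then show n: "n = n'" using step[of m] assms(3) by simp
  show "D = D'"
  proof
    fix i
    show "D i = D' i"
      using step[of i] n assms(1,2) by (cases "i \<in> {1..<m}") (auto simp: young_diagram_def)
  qed
qed

text \<open>The highest vector for one pair is a weight vector for the other, so its partial sums
  are dominated by those of the other pair. By symmetry they coincide.\<close>

lemma characterized_by_unique:
  assumes "2 \<le> m" "characterized_by m V \<rho> D n 0" "characterized_by m V \<rho> D' n' 0"
  shows "D = D'" "n = n'"
proof -
  have le: "weight_sums m D n j \<le> weight_sums m D' n' j"
    if char: "characterized_by m V \<rho> D n 0" "characterized_by m V \<rho> D' n' 0" and j: "j \<le> m"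
    for D D' n n' j
  proof -
    obtain x where x: "x \<in> V" "x \<noteq> 0"
      "\<And>j. j \<le> m \<Longrightarrow> \<rho> (torus m j) x = 2 powi weight_sums m D n j *\<^sub>R x"
      using characterized_by_eigenvector[OF char(1)] by blast
    show ?thesis
      using characterized_by_eigenvector_weight[OF char(2) x] j by blast
  qed
  have "weight_sums m D n j = weight_sums m D' n' j" if "j \<le> m" for j
    using le[OF assms(2,3) that] le[OF assms(3,2) that] by simp
  then show "D = D'" "n = n'"
    using weight_sums_inject[of m D D' n n'] assms by (auto simp: characterized_by_def)
qed

section \<open>Weights in a finite direct sum\<close>

lemma representation_sum:
  assumes V: "representation m V \<rho>" and A: "A \<in> GL m" and "finite S" "\<And>i. i \<in> S \<Longrightarrow> x i \<in> V"
  shows "\<rho> A (\<Sum>i\<in>S. x i) = (\<Sum>i\<in>S. \<rho> A (x i))"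
  using assms(3,4)
proof (induction S)
  case empty
  then show ?case using representation_zero[OF V A] by simp
next
  case (insert i S)
  then have "(\<Sum>i\<in>S. x i) \<in> V"
    by (intro subspace_sum[OF representation_subspace[OF V]]) auto
  then show ?case
    using insert representation_add[OF V A] by simp
qed

text \<open>The highest weight of a subrepresentation occurs as a weight of some summand. Only
  finitely many weights occur, and each determines \<open>(D, n)\<close>.\<close>

lemma finite_subrepresentation_types:
  assumes m: "2 \<le> m" and "finite_sum_of_irreps m V \<rho>"
  shows "finite {(D, n). \<exists>W\<subseteq>V. characterized_by m W \<rho> D n 0}"
proof -
  obtain r W where V: "representation m V \<rho>"
    and W: "\<And>i. i < r \<Longrightarrow> \<exists>D n. characterized_by m (W i) \<rho> D n 0"
    and VW: "V = {\<Sum>i<(r::nat). x i | x. \<forall>i<r. x i \<in> W i}"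
    and direct: "\<And>x. \<forall>i<r. x i \<in> W i \<Longrightarrow> (\<Sum>i<r. x i) = 0 \<Longrightarrow> \<forall>i<r. x i = 0"
    using assms(2) unfolding finite_sum_of_irreps_def by blast
  obtain DW nW where char: "\<And>i. i < r \<Longrightarrow> characterized_by m (W i) \<rho> (DW i) (nW i) 0"
    using W by metis
  have WR: "representation m (W i) \<rho>" if "i < r" for i
    using char[OF that] by (simp add: characterized_by_def isomorphic_reps_def)
  have W_le: "W i \<subseteq> V" if i: "i < r" for i
  proof
    fix x assume x: "x \<in> W i"
    have "(\<Sum>k<r. if k = i then x else 0) = x" using i by simp
    moreover have "\<forall>k<r. (if k = i then x else 0) \<in> W k"
      using x WR subspace_0[OF representation_subspace] by auto
    ultimately show "x \<in> V"
      unfolding VW mem_Collect_eq by (intro exI[of _ "\<lambda>k. if k = i then x else 0"]) simp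
  qed
  \<comment> \<open>The exponents of the basis tensor \<open>I\<close> in summand \<open>i\<close>,
    cut off in the same way as \<open>weight_sums\<close> so that the two can agree as
    functions.\<close>
  define g where "g i I = (\<lambda>j. if j \<le> m then int j * nW i + int (count_below j I) else 0)" for i I
  define E where "E = (\<Union>i<r. g i ` index_lists m (\<Sum>k=1..m. DW i k))"
  define T where "T = {(D, n). \<exists>W\<subseteq>V. characterized_by m W \<rho> D n 0}"
  have "weight_sums m D n \<in> E" if "(D, n) \<in> T" for D n
  proof -
    obtain W' where W': "W' \<subseteq> V" "characterized_by m W' \<rho> D n 0"
      using \<open>(D, n) \<in> T\<close> by (auto simp: T_def)
    obtain v where v: "v \<in> W'" "v \<noteq> 0"
      "\<And>j. j \<le> m \<Longrightarrow> \<rho> (torus m j) v = 2 powi weight_sums m D n j *\<^sub>R v"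
      using characterized_by_eigenvector[OF W'(2)] by blast
    obtain x where x: "v = (\<Sum>i<r. x i)" "\<forall>i<r. x i \<in> W i"
      using v(1) W'(1) VW by auto
    obtain i where i: "i < r" "x i \<noteq> 0"
      using v(2) x(1) by (metis lessThan_iff sum.neutral)
    \<comment> \<open>The defects \<open>?z k\<close> from the eigenvalue equation lie in their own
      summands and add up to 0, so directness makes each of them vanish.\<close>
    have eig: "\<rho> (torus m j) (x i) = 2 powi weight_sums m D n j *\<^sub>R x i" if j: "j \<le> m" for j
    proof -
      let ?c = "2 powi weight_sums m D n j :: real"
      let ?z = "\<lambda>k. \<rho> (torus m j) (x k) - ?c *\<^sub>R x k"
      have "\<rho> (torus m j) v = (\<Sum>k<r. \<rho> (torus m j) (x k))"
        unfolding x(1) by (rule representation_sum[OF V torus_GL]) (use x(2) W_le in auto)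
      then have "(\<Sum>k<r. ?z k) = 0"
        using v(3)[OF j] x(1) by (simp add: sum_subtractf scaleR_sum_right)
      moreover have "\<forall>k<r. ?z k \<in> W k"
      proof (intro allI impI)
        fix k assume k: "k < r"
        then have "x k \<in> W k" using x(2) by blast
        then show "?z k \<in> W k"
          using representation_closed[OF WR[OF k] torus_GL] representation_subspace[OF WR[OF k]]
          by (intro subspace_diff subspace_scale)
      qed
      ultimately have "?z i = 0" using direct[of ?z] i(1) by blast
      then show ?thesis by simp
    qed
    have "x i \<in> W i" using x(2) i(1) by blast
    then obtain I where I: "I \<in> index_lists m (\<Sum>k=1..m. DW i k)"
      "\<forall>j\<le>m. weight_sums m D n j = int j * nW i + int (count_below j I)"
      using characterized_by_eigenvector_weight[OF char[OF i(1)] _ i(2) eig] by blast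
    have "weight_sums m D n = g i I"
      using I(2) by (auto simp: g_def weight_sums_def fun_eq_iff)
    then show ?thesis using I(1) i(1) by (auto simp: E_def)
  qed
  then have "(\<lambda>(D, n). weight_sums m D n) ` T \<subseteq> E" by auto
  moreover have "finite E" by (simp add: E_def)
  ultimately have "finite ((\<lambda>(D, n). weight_sums m D n) ` T)" by (rule finite_subset)
  moreover have "inj_on (\<lambda>(D, n). weight_sums m D n) T"
  proof (rule inj_onI, clarify)
    fix D n D' n'
    assume "(D, n) \<in> T" "(D', n') \<in> T" and eq: "weight_sums m D n = weight_sums m D' n'"
    then have "young_diagram m D" "young_diagram m D'"
      by (auto simp: T_def characterized_by_def)
    then show "D = D' \<and> n = n'"
      using weight_sums_inject[of m D D' n n'] m eq by simp
  qed
  ultimately have "finite T" by (rule finite_imageD)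
  then show ?thesis by (simp add: T_def)
qed

subsection \<open>Resonant values\<close>

text \<open>For nonzero \<open>q\<close> in the branching set this is the root in
  \<open>\<delta>\<close> of the resonance equation for \<open>q\<close>.\<close>

definition resonance_value :: "nat \<Rightarrow> (nat \<Rightarrow> nat) \<Rightarrow> int \<Rightarrow> (nat \<Rightarrow> nat) \<Rightarrow> complex"
  where "resonance_value m D n q =
    (of_nat (size_of m q) *
        (2 * (of_nat m + 1) * (of_int n + 1) + 2 * of_nat (size_of m D) - of_nat (size_of m q)) +
      (\<Sum>i = 1..m. 2 * of_nat (D i) * of_nat (q i) - (of_nat (q i))\<^sup>2 - 2 * of_nat i * of_nat (q i)))
     / (2 * of_nat (size_of m q) * (of_nat m + 1))"

section \<open>The branching set\<close>

lemma branching_le: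
  assumes "q \<in> branching_set m D"
  shows "q i \<le> D i"
proof (cases "i \<in> {1..<m}")
  case True
  then have "q i \<le> D i - D (Suc i)" using assms by (simp add: branching_set_def)
  then show ?thesis by simp
next
  case False
  then show ?thesis using assms by (simp add: branching_set_def)
qed

lemma finite_branching_set [simp]: "finite (branching_set m D)"
proof (rule finite_subset)
  \<comment> \<open>The total size serves as a bound independent of \<open>i\<close>, which places
    the set among finitely many functions.\<close>
  show "branching_set m D \<subseteq>
      {q. \<forall>i. (i \<in> {1..<m} \<longrightarrow> q i \<in> {..\<Sum>i=1..<m. D i}) \<and> (i \<notin> {1..<m} \<longrightarrow> q i = 0)}"
  proof clarify
    fix q i assume q: "q \<in> branching_set m D"
    have "q i \<le> (\<Sum>i=1..<m. D i)" if "i \<in> {1..<m}"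
      using branching_le[OF q, of i] member_le_sum[OF that, of D] by simp
    then show "(i \<in> {1..<m} \<longrightarrow> q i \<in> {..\<Sum>i=1..<m. D i}) \<and> (i \<notin> {1..<m} \<longrightarrow> q i = 0)"
      using q by (auto simp: branching_set_def)
  qed
qed (intro finite_set_of_finite_funs; simp)

lemma size_of_eq:
  assumes "D m = 0"
  shows "size_of m D = (\<Sum>i=1..m. D i)"
proof (cases "m = 0")
  case False
  then have "{1..m} = insert m {1..<m}" by auto
  with assms show ?thesis by (simp add: size_of_def)
qed (simp add: size_of_def)

lemma size_of_branching_pos:
  assumes "q \<in> branching_set m D - {\<lambda>_. 0}"
  shows "0 < size_of m q"
proof -
  obtain i where "q i \<noteq> 0" using assms by (auto simp: fun_eq_iff)
  moreover from this have "i \<in> {1..<m}" using assms by (auto simp: branching_set_def)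
  ultimately show ?thesis
    using member_le_sum[of i "{1..<m}" q] by (simp add: size_of_def)
qed

text \<open>The Kronecker symbol collapses one summation. The coefficients \<open>a\<close> are
  complex so that the formula covers both \<open>D\<close> and the difference of \<open>D\<close>
  and \<open>q\<close>.\<close>

lemma alpha_double_sum:
  fixes a :: "nat \<Rightarrow> complex"
  shows "(\<Sum>i=1..m. \<Sum>j=1..m. a i * a j * (of_nat m * of_bool (i = j) - 1) +
      2 * a i * (of_nat m - of_nat j) * (of_nat m * of_bool (i = j) - 1)) =
    of_nat m * (\<Sum>i=1..m. (a i)\<^sup>2) - (\<Sum>i=1..m. a i)\<^sup>2 +
    2 * of_nat m * (\<Sum>i=1..m. a i * (of_nat m - of_nat i)) -
    (\<Sum>i=1..m. a i) * (of_nat m * (of_nat m - 1))"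
proof -
  let ?S = "\<Sum>i=1..m. a i"
  have tri: "(\<Sum>j=1..m. of_nat m - of_nat j :: complex) = of_nat m * (of_nat m - 1) / 2"
  proof -
    have "(\<Sum>j=1..k. of_nat j :: complex) = of_nat k * (of_nat k + 1) / 2" for k
      by (induction k) (simp_all add: field_simps)
    then show ?thesis by (simp add: sum_subtractf field_simps)
  qed
  have inner: "(\<Sum>j=1..m. a i * a j * (of_nat m * of_bool (i = j) - 1) +
      2 * a i * (of_nat m - of_nat j) * (of_nat m * of_bool (i = j) - 1)) =
    of_nat m * (a i)\<^sup>2 - a i * ?S + 2 * of_nat m * (a i * (of_nat m - of_nat i)) -
      a i * (of_nat m * (of_nat m - 1))" if i: "i \<in> {1..m}" for i
  proof -
    have "(\<Sum>j=1..m. a i * a j * (of_nat m * of_bool (i = j) - 1) +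
        2 * a i * (of_nat m - of_nat j) * (of_nat m * of_bool (i = j) - 1)) =
      (\<Sum>j=1..m. (if j = i then of_nat m * (a i * a j + 2 * a i * (of_nat m - of_nat j)) else 0)
        - a i * a j - 2 * a i * (of_nat m - of_nat j))"
      by (intro sum.cong refl) (simp add: algebra_simps)
    also have "\<dots> = of_nat m * (a i * a i + 2 * a i * (of_nat m - of_nat i)) - a i * ?S -
        2 * a i * (\<Sum>j=1..m. of_nat m - of_nat j)"
      using i by (simp only: sum_subtractf sum_distrib_left[symmetric] sum.delta finite_atLeastAtMost if_True)
    also have "\<dots> = of_nat m * (a i)\<^sup>2 - a i * ?S + 2 * of_nat m * (a i * (of_nat m - of_nat i)) -
        a i * (of_nat m * (of_nat m - 1))"
      unfolding tri by (simp add: field_simps power2_eq_square)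
    finally show ?thesis .
  qed
  have "(\<Sum>i=1..m. \<Sum>j=1..m. a i * a j * (of_nat m * of_bool (i = j) - 1) +
      2 * a i * (of_nat m - of_nat j) * (of_nat m * of_bool (i = j) - 1)) =
    (\<Sum>i=1..m. of_nat m * (a i)\<^sup>2 - a i * ?S + 2 * of_nat m * (a i * (of_nat m - of_nat i)) -
      a i * (of_nat m * (of_nat m - 1)))"
    by (intro sum.cong refl inner)
  also have "\<dots> = of_nat m * (\<Sum>i=1..m. (a i)\<^sup>2) - ?S * ?S +
      2 * of_nat m * (\<Sum>i=1..m. a i * (of_nat m - of_nat i)) - ?S * (of_nat m * (of_nat m - 1))"
    by (simp only: sum_subtractf sum.distrib sum_distrib_left[symmetric] sum_distrib_right[symmetric])
  finally show ?thesis by (simp add: power2_eq_square)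
qed

lemma alpha_eq_iff:
  assumes D: "young_diagram m D" and m: "2 \<le> m" and q: "q \<in> branching_set m D - {\<lambda>_. 0}"
  shows "alpha m (\<lambda>i. D i - q i) n \<delta> = alpha m D n \<delta> \<longleftrightarrow> \<delta> = resonance_value m D n q"
proof -
  define M where "M = (of_nat m :: complex)"
  define a b where "a i = (of_nat (D i) :: complex)" and "b i = (of_nat (q i) :: complex)" for i
  define s c where "s = (\<Sum>i=1..m. a i)" and "c = (\<Sum>i=1..m. b i)"
  define X Y where "X = (\<Sum>i=1..m. 2 * a i * b i - (b i)\<^sup>2)" and "Y = (\<Sum>i=1..m. of_nat i * b i)"
  define P Z where "P = (\<Sum>i=1..m. (a i)\<^sup>2)" and "Z = (\<Sum>i=1..m. a i * (M - of_nat i))"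
  have "M + 1 = of_nat (Suc m)" by (simp add: M_def)
  then have M: "M \<noteq> 0" "M + 1 \<noteq> 0"
    using m by (simp_all only: M_def of_nat_eq_0_iff)
  have Dm: "D m = 0" "q m = 0" using D q by (auto simp: young_diagram_def branching_set_def)
  \<comment> \<open>The natural subtraction is exact because \<open>q i\<close> is at most
    \<open>D i\<close>.\<close>
  have diff: "of_nat (D i - q i) = a i - b i" for i
    using branching_le[of q m D i] q by (simp add: a_def b_def of_nat_diff)
  have size: "of_nat (size_of m D) = s" "of_nat (size_of m q) = c"
    "of_nat (size_of m (\<lambda>i. D i - q i)) = s - c"
    using Dm diff by (simp_all add: size_of_eq s_def c_def a_def b_def sum_subtractf)
  have "c \<noteq> 0" using size_of_branching_pos[OF q] size(2) by auto
  have alpha1: "alpha m D n \<delta> =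
      (M * (of_int n - \<delta>) + s) * (M * (of_int n + 1 - \<delta>) + s) / (2 * M) +
      1 / (2 * M * (M + 1)) * (M * P - s\<^sup>2 + 2 * M * Z - s * (M * (M - 1)))"
    unfolding alpha_def size a_def[symmetric] alpha_double_sum
    by (simp add: M_def s_def P_def Z_def)
  have P: "(\<Sum>i=1..m. (a i - b i)\<^sup>2) = P - X"
    by (simp add: P_def X_def power2_eq_square algebra_simps sum_subtractf sum.distrib)
  have Z: "(\<Sum>i=1..m. (a i - b i) * (M - of_nat i)) = Z - M * c + Y"
    by (simp add: Z_def c_def Y_def algebra_simps sum_subtractf sum.distrib sum_distrib_left)
  have s: "(\<Sum>i=1..m. a i - b i) = s - c"
    by (simp add: s_def c_def sum_subtractf)
  have alpha2: "alpha m (\<lambda>i. D i - q i) n \<delta> =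
      (M * (of_int n - \<delta>) + (s - c)) * (M * (of_int n + 1 - \<delta>) + (s - c)) / (2 * M) +
      1 / (2 * M * (M + 1)) *
        (M * (P - X) - (s - c)\<^sup>2 + 2 * M * (Z - M * c + Y) - (s - c) * (M * (M - 1)))"
    unfolding alpha_def size diff alpha_double_sum s P[symmetric] Z[symmetric]
    by (simp add: M_def)
  have val: "resonance_value m D n q =
      (c * (2 * (M + 1) * (of_int n + 1) + 2 * s - c) + X - 2 * Y) / (2 * c * (M + 1))"
  proof -
    have "(\<Sum>i=1..m. 2 * a i * b i - (b i)\<^sup>2 - 2 * of_nat i * b i) = X - 2 * Y"
      by (simp add: X_def Y_def sum_subtractf sum_distrib_left mult.assoc)
    then show ?thesis
      unfolding resonance_value_def size a_def[symmetric] b_def[symmetric] M_def[symmetric]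
      by (simp add: algebra_simps)
  qed
  have common_denominator: "A1 / (2 * M) + 1 / (2 * M * L) * B1 - (A2 / (2 * M) + 1 / (2 * M * L) * B2) =
      ((A1 - A2) * L + (B1 - B2)) / (2 * M * L)" if "M \<noteq> 0" "L \<noteq> 0" for L A1 A2 B1 B2 :: complex
    using that by (simp add: field_simps)
  have factor_out: "M * (N - 2 * c * L * \<delta>) / (2 * M * L) = c * (N / (2 * c * L) - \<delta>)"
    if "M \<noteq> 0" "L \<noteq> 0" for L N :: complex
    using that \<open>c \<noteq> 0\<close> by (simp add: field_simps)
  define A1 A2 B1 B2 N where
    "A1 = (M * (of_int n - \<delta>) + s) * (M * (of_int n + 1 - \<delta>) + s)" and
    "A2 = (M * (of_int n - \<delta>) + (s - c)) * (M * (of_int n + 1 - \<delta>) + (s - c))" and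
    "B1 = M * P - s\<^sup>2 + 2 * M * Z - s * (M * (M - 1))" and
    "B2 = M * (P - X) - (s - c)\<^sup>2 + 2 * M * (Z - M * c + Y) - (s - c) * (M * (M - 1))" and
    "N = c * (2 * (M + 1) * (of_int n + 1) + 2 * s - c) + X - 2 * Y"
  \<comment> \<open>The squares of \<open>\<delta>\<close> cancel in \<open>A1 - A2\<close>, and the
    terms \<open>2 * s * c\<close> and \<open>c\<^sup>2\<close> not divisible by \<open>M\<close>
    cancel against those in \<open>B1 - B2\<close>. What remains is linear in
    \<open>\<delta>\<close>.\<close>
  have "(A1 - A2) * (M + 1) + (B1 - B2) = M * (N - 2 * c * (M + 1) * \<delta>)"
    unfolding A1_def A2_def B1_def B2_def N_def by (simp add: algebra_simps power2_eq_square)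
  moreover have "alpha m D n \<delta> - alpha m (\<lambda>i. D i - q i) n \<delta> =
      ((A1 - A2) * (M + 1) + (B1 - B2)) / (2 * M * (M + 1))"
    unfolding alpha1 alpha2 A1_def[symmetric] A2_def[symmetric] B1_def[symmetric] B2_def[symmetric]
    by (rule common_denominator[OF M])
  moreover have "M * (N - 2 * c * (M + 1) * \<delta>) / (2 * M * (M + 1)) =
      c * (resonance_value m D n q - \<delta>)"
    unfolding val N_def[symmetric] by (rule factor_out[OF M])
  ultimately have "alpha m D n \<delta> - alpha m (\<lambda>i. D i - q i) n \<delta> =
      c * (resonance_value m D n q - \<delta>)" by simp
  then show ?thesis using \<open>c \<noteq> 0\<close> by (metis eq_iff_diff_eq_0 mult_eq_0_iff)
qed

text \<open>The numerator is positive: the factor next to \<open>c\<close> is at least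
  \<open>2 * (m + 1)\<close> because \<open>c \<le> d\<close> and \<open>n\<close> is nonnegative,
  while the remaining sum is at least \<open>- 2 * m * c\<close>. Together they leave at least
  \<open>2 * c\<close>.\<close>

lemma resonance_value_nonzero:
  assumes D: "young_diagram m D" and q: "q \<in> branching_set m D - {\<lambda>_. 0}" and n: "0 \<le> n"
  shows "resonance_value m D n q \<noteq> 0"
proof -
  \<comment> \<open>The estimate is made over the integers; the complex value is a quotient of two
    of them.\<close>
  define c d where "c = int (size_of m q)" and "d = int (size_of m D)"
  have c: "0 < c" using size_of_branching_pos[OF q] by (simp add: c_def)
  have qD: "q i \<le> D i" for i using q by (intro branching_le) auto
  have cd: "c \<le> d" unfolding c_def d_def size_of_def by (simp add: sum_mono qD)
  have "q m = 0" using q by (simp add: branching_set_def)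
  then have c': "c = (\<Sum>i=1..m. int (q i))" by (simp add: c_def size_of_eq)
  define S where "S = (\<Sum>i = 1..m. 2 * int (D i) * int (q i) - (int (q i))\<^sup>2 - 2 * int i * int (q i))"
  \<comment> \<open>Since \<open>q i \<le> D i\<close>, the quadratic part of each term is
    nonnegative, and \<open>i \<le> m\<close> bounds the linear part.\<close>
  have "(\<Sum>i=1..m. - 2 * int m * int (q i)) \<le> S"
    unfolding S_def
  proof (rule sum_mono)
    fix i assume "i \<in> {1..m}"
    then have "int i * int (q i) \<le> int m * int (q i)" by (intro mult_right_mono) auto
    moreover have "int (q i) * int (q i) \<le> int (D i) * int (q i)"
      using qD[of i] by (intro mult_right_mono) auto
    moreover have "0 \<le> int (D i) * int (q i)" by simp
    ultimately show "- 2 * int m * int (q i) \<le>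
        2 * int (D i) * int (q i) - (int (q i))\<^sup>2 - 2 * int i * int (q i)"
      unfolding power2_eq_square by linarith
  qed
  also have "(\<Sum>i=1..m. - 2 * int m * int (q i)) = - 2 * int m * c"
    unfolding c' sum_distrib_left ..
  finally have S: "- 2 * int m * c \<le> S" .
  have "2 * (int m + 1) * 1 \<le> 2 * (int m + 1) * (n + 1)"
    using n by (intro mult_left_mono) auto
  then have "2 * (int m + 1) \<le> 2 * (int m + 1) * (n + 1) + 2 * d - c"
    using c cd by linarith
  then have "c * (2 * (int m + 1)) \<le> c * (2 * (int m + 1) * (n + 1) + 2 * d - c)"
    using c by (intro mult_left_mono) auto
  with S c have "0 < c * (2 * (int m + 1) * (n + 1) + 2 * d - c) + S"
    by (simp add: algebra_simps)
  moreover have "resonance_value m D n q =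
      of_int (c * (2 * (int m + 1) * (n + 1) + 2 * d - c) + S) / of_int (2 * c * (int m + 1))"
    by (simp add: resonance_value_def c_def d_def S_def)
  moreover have "2 * c * (int m + 1) \<noteq> 0" using c by simp
  ultimately show ?thesis by (simp only: divide_eq_0_iff of_int_eq_0_iff) simp
qed

text \<open>Resonance quantifies over every pair \<open>(D, n)\<close> characterizing the
  representation; uniqueness of the pair reduces it to the given one.\<close>

lemma resonant_irrep_iff:
  assumes "2 \<le> m" "characterized_by m V \<rho> D n 0"
  shows "resonant_irrep m V \<rho> \<delta> \<longleftrightarrow> \<delta> \<in> resonance_value m D n ` (branching_set m D - {\<lambda>_. 0})"
proof -
  have D: "young_diagram m D" using assms(2) by (simp add: characterized_by_def)
  have "resonant_irrep m V \<rho> \<delta> \<longleftrightarrow>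
      (\<exists>q\<in>branching_set m D - {\<lambda>_. 0}. alpha m (\<lambda>i. D i - q i) n \<delta> = alpha m D n \<delta>)"
  proof
    assume "resonant_irrep m V \<rho> \<delta>"
    then obtain D' n' where "characterized_by m V \<rho> D' n' 0"
      "\<exists>q\<in>branching_set m D' - {\<lambda>_. 0}. alpha m (\<lambda>i. D' i - q i) n' \<delta> = alpha m D' n' \<delta>"
      unfolding resonant_irrep_def by blast
    then show "\<exists>q\<in>branching_set m D - {\<lambda>_. 0}. alpha m (\<lambda>i. D i - q i) n \<delta> = alpha m D n \<delta>"
      using characterized_by_unique[OF assms] by simp
  next
    assume "\<exists>q\<in>branching_set m D - {\<lambda>_. 0}. alpha m (\<lambda>i. D i - q i) n \<delta> = alpha m D n \<delta>"
    with assms(2) show "resonant_irrep m V \<rho> \<delta>"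
      unfolding resonant_irrep_def by blast
  qed
  also have "\<dots> \<longleftrightarrow> \<delta> \<in> resonance_value m D n ` (branching_set m D - {\<lambda>_. 0})"
    using alpha_eq_iff[OF D assms(1)] by blast
  finally show ?thesis .
qed

text \<open>In both branches of the definition a resonant value comes from some \<open>W\<close>
  inside \<open>V\<close> with a characterizing pair. There are finitely many pairs, each with
  finitely many \<open>q\<close>.\<close>

lemma finite_resonant:
  assumes m: "2 \<le> m" and "finite_sum_of_irreps m V \<rho>"
  shows "finite {\<delta>. resonant m V \<rho> \<delta>}"
proof (rule finite_subset)
  let ?T = "{(D, n). \<exists>W\<subseteq>V. characterized_by m W \<rho> D n 0}"
  let ?R = "\<Union>(D, n)\<in>?T. resonance_value m D n ` (branching_set m D - {\<lambda>_. 0})"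
  show "finite ?R"
    using finite_subrepresentation_types[OF assms] by (intro finite_UN_I) auto
  show "{\<delta>. resonant m V \<rho> \<delta>} \<subseteq> ?R"
  proof
    fix \<delta> assume "\<delta> \<in> {\<delta>. resonant m V \<rho> \<delta>}"
    then obtain W where W: "W \<subseteq> V" "resonant_irrep m W \<rho> \<delta>"
      by (auto simp: resonant_def split: if_splits)
    then obtain D n where char: "characterized_by m W \<rho> D n 0"
      unfolding resonant_irrep_def by blast
    then have "\<delta> \<in> resonance_value m D n ` (branching_set m D - {\<lambda>_. 0})"
      using W(2) resonant_irrep_iff[OF m] by blast
    moreover have "(D, n) \<in> ?T" using W(1) char by blast
    ultimately show "\<delta> \<in> ?R" by blast
  qed
qed

theorem mainTheorem2:
  fixes m :: nat and V :: "'v::real_vector set" and \<rho> :: "real mat \<Rightarrow> 'v \<Rightarrow> 'v"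
    and D :: "nat \<Rightarrow> nat" and n :: int
  assumes "2 \<le> m"
  shows "(characterized_by m V \<rho> D n 0 \<longrightarrow>
      {\<delta>. resonant m V \<rho> \<delta>} =
      {(of_nat (size_of m q) *
          (2 * (of_nat m + 1) * (of_int n + 1) + 2 * of_nat (size_of m D) - of_nat (size_of m q)) +
        (\<Sum>i = 1..m. 2 * of_nat (D i) * of_nat (q i) - (of_nat (q i))\<^sup>2 - 2 * of_nat i * of_nat (q i)))
       / (2 * of_nat (size_of m q) * (of_nat m + 1))
       | q. q \<in> branching_set m D - {\<lambda>_. 0}}) \<and>
    (finite_sum_of_irreps m V \<rho> \<longrightarrow> finite {\<delta>. resonant m V \<rho> \<delta>}) \<and>
    (characterized_by m V \<rho> D n 0 \<and> 0 \<le> n \<longrightarrow> \<not> resonant m V \<rho> 0)"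
proof -
  \<comment> \<open>Irreducibility of \<open>V\<close> selects the first branch in the definition of
    resonance.\<close>
  have res: "{\<delta>. resonant m V \<rho> \<delta>} = {resonance_value m D n q | q. q \<in> branching_set m D - {\<lambda>_. 0}}"
    if char: "characterized_by m V \<rho> D n 0"
    using characterized_by_irreducible[OF char] resonant_irrep_iff[OF assms char]
    by (auto simp: resonant_def)
  moreover have "\<not> resonant m V \<rho> 0" if char: "characterized_by m V \<rho> D n 0" and n: "0 \<le> n"
  proof
    assume "resonant m V \<rho> 0"
    then have "0 \<in> {\<delta>. resonant m V \<rho> \<delta>}" by simp
    then obtain q where "q \<in> branching_set m D - {\<lambda>_. 0}" "resonance_value m D n q = 0"
      unfolding res[OF char] by auto
    moreover have "young_diagram m D" using char by (simp add: characterized_by_def)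
    ultimately show False using resonance_value_nonzero n by blast
  qed
  ultimately show ?thesis
    using finite_resonant[OF assms] unfolding resonance_value_def by blast
qed

end
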